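(* Let $k\leq n$ and $d$ be positive integers, let $\lambda\vdash nd$, $\mu\vdash kd$ with $\mu\subset\lambda$, and let $F:D_\lambda\to[n]$ be a Young$^d_n$ tableau with $F^{-1}([k])=D_\mu$. Let $\mathcal{G}$ be the set of Young$^d_n$ tableaux $G:D_\lambda\to[n]$ such that (1) $G^{-1}(i)\preceq F^{-1}(i)$ for all $i\in[k]$, with $G^{-1}(i)\prec F^{-1}(i)$ for at least one $i\in[k]$; and (2) $G^{-1}([k])=D_\delta$ for some partition $\delta\subset\lambda$. Writing $F_0=F|_{D_\mu}$, we have in $\mathscr{S}^{(d)}$ \[[F]\in\mathscr{I}([F_0])+\mathscr{I}([G]:G\in\mathcal{G}),\] and in particular, writing $G_0$ for the restriction of $G$ to $G^{-1}([k])$, \[[F]\in\mathscr{I}([F_0])+\mathscr{I}([G_0]:G\in\mathcal{G}).\]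
   Context: $\mathbb{K}$ is a field of characteristic zero; $[n]=\{1,\dots,n\}$; permutations are multiplied by composition. A Young tableau of shape $\lambda$ with entries in $A$ is a bijection $T:D_\lambda\to A$, $D_\lambda=\{(i,j):1\leq j\leq\lambda_i\}$, with rows $R_i(T)$ and columns $C_j(T)$; $\mathfrak{c}_\lambda(T)=\prod_i\mathfrak{a}(R_i(T))\cdot\prod_j\mathfrak{b}(C_j(T))\in\mathbb{K}[\mathfrak{S}_A]$, where $\mathfrak{a}(X)=\sum_{\sigma\in\mathfrak{S}_X}\sigma$, $\mathfrak{b}(X)=\sum_{\tau\in\mathfrak{S}_X}\mathrm{sgn}(\tau)\tau$. The algebra $\mathscr{S}^{(d)}$ assigns to each finite set $A$ with $|A|=md$ the vector space $\mathscr{S}^{(d)}_A$ with basis the monomials $z_{\underline{A}}=z_{A_1}\cdots z_{A_m}$ in commuting variables $z_{A_i}$, where $\underline{A}$ runs over the set partitions $A=A_1\sqcup\cdots\sqcup A_m$ with $|A_i|=d$; bijections $\phi:A\to A'$ act by $z_{A_1}\cdots z_{A_m}\mapsto z_{\phi(A_1)}\cdots z_{\phi(A_m)}$ (so $\mathbb{K}[\mathfrak{S}_A]$ acts on $\mathscr{S}^{(d)}_A$), and for disjoint $A,B$ the product $\mathscr{S}^{(d)}_A\otimes\mathscr{S}^{(d)}_B\to\mathscr{S}^{(d)}_{A\sqcup B}$ is multiplication of monomials. An ideal is a family of subspaces $\mathscr{I}_A\subseteq\mathscr{S}^{(d)}_A$ preserved by the maps induced by bijections with $\mathscr{I}_A\cdot\mathscr{S}^{(d)}_B\subseteq\mathscr{I}_{A\sqcup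 B}$; generated ideals and sums are as usual. A Young$^d_n$ tableau of shape $\lambda\vdash nd$ is a function $F:D_\lambda\to[n]$ with $|F^{-1}(i)|=d$ for all $i\in[n]$. For a Young tableau $T:D_\lambda\to A$, $T\circ F^{-1}$ denotes the partition $\underline{A}$ with $A_i=T(F^{-1}(i))$; the Young$^d_n$ tabloid $[F]$ is the collection of elements $t_F(A,T)=\mathfrak{c}_\lambda(T)\cdot z_{T\circ F^{-1}}\in\mathscr{S}^{(d)}_A$ over all $A$ with $|A|=nd$ and all Young tableaux $T:D_\lambda\to A$; $\mathscr{I}([F])$ is the ideal generated by these elements. (Restrictions of $F$ or $G$ to the preimage of $[k]$ are Young$^d_k$ tableaux, with tabloids defined in the same way.) For $d$-element sets of boxes $X=\{(x_i,y_i)\}_{i\in[d]}$, $X'=\{(x'_i,y'_i)\}_{i\in[d]}$ indexed so that $y_1\leq\cdots\leq y_d$ and $y'_1\leq\cdots\leq y'_d$, write $X\preceq X'$ if $y_i\leq y'_i$ for all $i$, and $X\prec X'$ if $X\preceq X'$ and $y_i<y'_i$ for some $i$. *)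

theory Defs
  imports
    Complex_Main
    "HOL-Library.Poly_Mapping"
    "HOL-Library.Multiset"
    "HOL-Library.FuncSet"
    "HOL-Library.Disjoint_Sets"
    "HOL-Combinatorics.Permutations"
begin

section \<open>Polynomials in the commuting variables \<open>z\<^sub>X\<close>\<close>

text \<open>
  A monomial is a finite multiset of sets (the indices of its variables, with multiplicity), and
  the product of \<^typ>\<open>'b \<Rightarrow>\<^sub>0 'k\<close> makes the following the polynomial ring over \<open>'k\<close>
  in variables indexed by the subsets of \<open>'a\<close>.
\<close>

type_synonym ('a, 'k) zpoly = "'a set multiset \<Rightarrow>\<^sub>0 'k"

definition zvar :: "'a set \<Rightarrow> ('a, 'k::field) zpoly" where
  "zvar X = Poly_Mapping.single {#X#} 1"

definition zscale :: "'k::field \<Rightarrow> ('a, 'k) zpoly \<Rightarrow> ('a, 'k) zpoly" where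
  "zscale c p = Poly_Mapping.single 0 c * p"

interpretation zp: vector_space "zscale :: 'k::field \<Rightarrow> ('a, 'k) zpoly \<Rightarrow> ('a, 'k) zpoly"
  by unfold_locales
    (simp_all add: zscale_def algebra_simps single_add mult_single flip: mult.assoc)

definition zact :: "('a \<Rightarrow> 'a) \<Rightarrow> ('a, 'k::field) zpoly \<Rightarrow> ('a, 'k) zpoly" where
  "zact \<phi> p =
     (\<Sum>m\<in>Poly_Mapping.keys p.
        Poly_Mapping.single (image_mset (image \<phi>) m) (Poly_Mapping.lookup p m))"


section \<open>The algebra \<open>S\<^sup>(\<^sup>d\<^sup>)\<close> and its ideals\<close>

text \<open>
  The finite sets \<open>A\<close> are the finite subsets of an arbitrary type \<open>'a\<close>. If \<open>d\<close> does not divide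
  the cardinality of \<open>A\<close>, there is no set partition into \<open>d\<close>-element blocks, and the space
  attached to \<open>A\<close> is zero.
\<close>

definition S_space :: "nat \<Rightarrow> 'a set \<Rightarrow> ('a, 'k::field) zpoly set" where
  "S_space d A = zp.span {\<Prod>X\<in>P. zvar X | P. partition_on A P \<and> (\<forall>X\<in>P. card X = d)}"

text \<open>
  Ideals and generating sets are families indexed by sets; only their values at finite sets matter.
\<close>

type_synonym ('a, 'k) family = "'a set \<Rightarrow> ('a, 'k) zpoly set"

definition is_ideal :: "nat \<Rightarrow> ('a, 'k::field) family \<Rightarrow> bool" where
  "is_ideal d I \<longleftrightarrow>
     (\<forall>A. finite A \<longrightarrow> zp.subspace (I A) \<and> I A \<subseteq> S_space d A) \<and>
     (\<forall>A A' \<phi>. finite A \<longrightarrow> bij_betw \<phi> A A' \<longrightarrow> zact \<phi> ` I A \<subseteq> I A') \<and>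
     (\<forall>A B. finite A \<longrightarrow> finite B \<longrightarrow> A \<inter> B = {} \<longrightarrow>
        (\<forall>p\<in>I A. \<forall>q\<in>S_space d B. p * q \<in> I (A \<union> B)))"

definition ideal_gen :: "nat \<Rightarrow> ('a, 'k::field) family \<Rightarrow> ('a, 'k) family" where
  "ideal_gen d X A = \<Inter>{I A | I. is_ideal d I \<and> (\<forall>B. finite B \<longrightarrow> X B \<subseteq> I B)}"

definition ideal_sum :: "('a, 'k::field) family \<Rightarrow> ('a, 'k) family \<Rightarrow> ('a, 'k) family" where
  "ideal_sum I J A = {p + q | p q. p \<in> I A \<and> q \<in> J A}"


section \<open>Group algebras of symmetric groups\<close>

text \<open>
  The group algebra of the symmetric group of \<open>A\<close> consists of the elements below whose keys
  permute \<open>A\<close> (and hence fix everything outside \<open>A\<close>).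
\<close>

type_synonym ('a, 'k) galg = "('a \<Rightarrow> 'a) \<Rightarrow>\<^sub>0 'k"

definition ga_one :: "('a, 'k::field) galg" where
  "ga_one = Poly_Mapping.single id 1"

definition ga_mult :: "('a, 'k::field) galg \<Rightarrow> ('a, 'k) galg \<Rightarrow> ('a, 'k) galg" where
  "ga_mult f g =
     (\<Sum>\<sigma>\<in>Poly_Mapping.keys f. \<Sum>\<tau>\<in>Poly_Mapping.keys g.
        Poly_Mapping.single (\<sigma> \<circ> \<tau>)
          (Poly_Mapping.lookup f \<sigma> * Poly_Mapping.lookup g \<tau>))"

definition ga_prod :: "('a, 'k::field) galg list \<Rightarrow> ('a, 'k) galg" where
  "ga_prod fs = foldr ga_mult fs ga_one"

definition ga_act :: "('a, 'k::field) galg \<Rightarrow> ('a, 'k) zpoly \<Rightarrow> ('a, 'k) zpoly" where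
  "ga_act f p =
     (\<Sum>\<sigma>\<in>Poly_Mapping.keys f. zscale (Poly_Mapping.lookup f \<sigma>) (zact \<sigma> p))"

definition row_sym :: "'a set \<Rightarrow> ('a, 'k::field) galg" where
  "row_sym X = (\<Sum>\<sigma> | \<sigma> permutes X. Poly_Mapping.single \<sigma> 1)"

definition col_sym :: "'a set \<Rightarrow> ('a, 'k::field) galg" where
  "col_sym X = (\<Sum>\<tau> | \<tau> permutes X. Poly_Mapping.single \<tau> (of_int (sign \<tau>)))"


section \<open>Partitions and tableaux\<close>

type_synonym box = "nat \<times> nat"

definition is_partition :: "nat list \<Rightarrow> bool" where
  "is_partition l \<longleftrightarrow> sorted_wrt (\<ge>) l \<and> 0 \<notin> set l"

definition part :: "nat list \<Rightarrow> nat \<Rightarrow> nat" where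
  "part l i = (if 1 \<le> i \<and> i \<le> length l then l ! (i - 1) else 0)"

definition diagram :: "nat list \<Rightarrow> box set" where
  "diagram l = {(i, j). 1 \<le> i \<and> 1 \<le> j \<and> j \<le> part l i}"

definition young_symmetrizer :: "nat list \<Rightarrow> (box \<Rightarrow> 'a) \<Rightarrow> ('a, 'k::field) galg" where
  "young_symmetrizer l T =
     ga_mult
       (ga_prod (map (\<lambda>i. row_sym (T ` {b \<in> diagram l. fst b = i})) [1..<Suc (length l)]))
       (ga_prod (map (\<lambda>j. col_sym (T ` {b \<in> diagram l. snd b = j})) [1..<Suc (part l 1)]))"

text \<open>
  The preimage of \<open>i\<close> under a function with domain \<open>diagram l\<close>; such functions are represented
  extensionally where sets of them are formed.
\<close>

definition fiber :: "nat list \<Rightarrow> (box \<Rightarrow> nat) \<Rightarrow> nat \<Rightarrow> box set" where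
  "fiber l F i = {b \<in> diagram l. F b = i}"

definition young_dn_tableau :: "nat \<Rightarrow> nat \<Rightarrow> nat list \<Rightarrow> (box \<Rightarrow> nat) \<Rightarrow> bool" where
  "young_dn_tableau d n l F \<longleftrightarrow>
     F \<in> diagram l \<rightarrow>\<^sub>E {1..n} \<and> (\<forall>i\<in>{1..n}. card (fiber l F i) = d)"

definition t_elem :: "nat \<Rightarrow> nat list \<Rightarrow> (box \<Rightarrow> nat) \<Rightarrow> (box \<Rightarrow> 'a) \<Rightarrow> ('a, 'k::field) zpoly" where
  "t_elem n l F T = ga_act (young_symmetrizer l T) (\<Prod>i\<in>{1..n}. zvar (T ` fiber l F i))"

definition tabloid :: "nat \<Rightarrow> nat list \<Rightarrow> (box \<Rightarrow> nat) \<Rightarrow> ('a, 'k::field) family" where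
  "tabloid n l F A = {t_elem n l F T | T. bij_betw T (diagram l) A}"


section \<open>The order on sets of boxes\<close>

definition columns :: "box set \<Rightarrow> nat list" where
  "columns X = sorted_list_of_multiset (image_mset snd (mset_set X))"

definition boxes_le :: "box set \<Rightarrow> box set \<Rightarrow> bool" where
  "boxes_le X X' \<longleftrightarrow> list_all2 (\<le>) (columns X) (columns X')"

definition boxes_less :: "box set \<Rightarrow> box set \<Rightarrow> bool" where
  "boxes_less X X' \<longleftrightarrow>
     boxes_le X X' \<and> (\<exists>i < length (columns X). columns X ! i < columns X' ! i)"

definition initial_boxes :: "nat \<Rightarrow> nat list \<Rightarrow> (box \<Rightarrow> nat) \<Rightarrow> box set" where
  "initial_boxes k l F = {b \<in> diagram l. F b \<in> {1..k}}"

definition smaller_tableaux ::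
    "nat \<Rightarrow> nat \<Rightarrow> nat \<Rightarrow> nat list \<Rightarrow> (box \<Rightarrow> nat) \<Rightarrow> (box \<Rightarrow> nat) set" where
  "smaller_tableaux d n k l F =
     {G. young_dn_tableau d n l G \<and>
         (\<forall>i\<in>{1..k}. boxes_le (fiber l G i) (fiber l F i)) \<and>
         (\<exists>i\<in>{1..k}. boxes_less (fiber l G i) (fiber l F i)) \<and>
         (\<exists>\<delta>. is_partition \<delta> \<and> diagram \<delta> \<subseteq> diagram l \<and> initial_boxes k l G = diagram \<delta>)}"

text \<open>
  The tabloid of the restriction of \<open>G\<close> to the preimage of \<open>{1..k}\<close>. A partition is determined by
  its diagram, so the union has at most one member.
\<close>

definition initial_tabloid ::
    "nat \<Rightarrow> nat list \<Rightarrow> (box \<Rightarrow> nat) \<Rightarrow> ('a, 'k::field) family" where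
  "initial_tabloid k l G A =
     \<Union>{tabloid k \<delta> (restrict G (diagram \<delta>)) A | \<delta>.
         is_partition \<delta> \<and> initial_boxes k l G = diagram \<delta>}"

end

theory Submission
  imports Defs
begin

text \<open>
  Let \<open>c(T)\<close> be the Young symmetrizer of \<open>T\<close>, let \<open>S\<close> be the restriction of \<open>T\<close> to the diagram of
  \<open>\<mu>\<close>, let \<open>P\<close> be its set of entries, and consider \<open>c(T) c(S) z\<close> for the monomial \<open>z\<close> of \<open>F\<close>. It
  lies in the ideal of \<open>F\<^sub>0\<close>, since \<open>c(S)\<close> does not affect the blocks of \<open>z\<close> outside \<open>P\<close>. On the
  other hand, the antisymmetrizer inside \<open>c(S)\<close> allows the Garnir relations of \<open>c(T)\<close> to rewrite
  \<open>c(T) c(S)\<close> as \<open>\<gamma> c(T)\<close> plus a combination of elements \<open>c(T) \<sigma>\<close> in which no label of \<open>P\<close> moves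
  to the right and at least one moves to the left. The scalar \<open>\<gamma>\<close> depends on \<open>S\<close> only, so the case
  \<open>T = S\<close>, that is \<open>c(S)\<^sup>2 = \<gamma> c(S)\<close>, shows that it is nonzero. Further Garnir relations, which move
  labels of \<open>P\<close> to the left only, turn the region occupied by \<open>P\<close> into the diagram of a partition.
  The second inclusion follows from the first by induction on the sum of the columns of the boxes
  filled with \<open>1, \<dots>, k\<close>.
\<close>

section \<open>Permutations preserving the fibers of a function\<close>

text \<open>A column permutation to the left of \<sigma> changes \<open>c(T) \<sigma>\<close> only
  by its sign, so up to sign this element records just the column of each label. This is why the
  order on sets of boxes compares columns alone, and why weakly decreasing column counts suffice to
  reach a diagram. The row symmetrizer in \<open>c(S)\<close> throws labels of \<open>P\<close> to
  the right. An exchange returns one of them to its original column but sends its partner to the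
  right, so termination needs a weight. Partners from the same original column are absorbed by
  antisymmetry at the price of divisions by integers, where characteristic zero is used. These
  divisions leave no evident formula for \<gamma>, so its nonvanishing is shown indirectly. None of
  this involves the monomial: \<Phi> stays arbitrary and is later the action on \<open>z\<close> or
  a coefficient function.\<close>

definition fiber_perms :: "('a \<Rightarrow> 'b) \<Rightarrow> 'a set \<Rightarrow> ('a \<Rightarrow> 'a) set" where
  "fiber_perms f A = {p. p permutes A \<and> (\<forall>x. f (p x) = f x)}"

lemma fiber_perms_permutes: "p \<in> fiber_perms f A \<Longrightarrow> p permutes A"
  by (simp add: fiber_perms_def)

lemma finite_fiber_perms: "finite A \<Longrightarrow> finite (fiber_perms f A)"
  by (rule finite_subset[OF _ finite_permutations]) (auto simp: fiber_perms_def)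

lemma id_in_fiber_perms: "id \<in> fiber_perms f A"
  by (simp add: fiber_perms_def permutes_id)

lemma comp_in_fiber_perms:
  "p \<in> fiber_perms f A \<Longrightarrow> q \<in> fiber_perms f A \<Longrightarrow> p \<circ> q \<in> fiber_perms f A"
  by (auto simp: fiber_perms_def permutes_compose)

lemma inv_in_fiber_perms:
  assumes "p \<in> fiber_perms f A"
  shows "inv p \<in> fiber_perms f A"
proof -
  have p: "p permutes A" "\<And>x. f (p x) = f x"
    using assms by (auto simp: fiber_perms_def)
  have "f (inv p x) = f x" for x
    using p(2)[of "inv p x"] by (simp add: permutes_inverses[OF p(1)])
  then show ?thesis
    using p(1) by (simp add: fiber_perms_def permutes_inv)
qed

lemma transpose_in_fiber_perms:
  "x \<in> A \<Longrightarrow> y \<in> A \<Longrightarrow> f x = f y \<Longrightarrow> transpose x y \<in> fiber_perms f A"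
  by (auto simp: fiber_perms_def permutes_swap_id transpose_def)

lemma fiber_perms_mono: "A \<subseteq> B \<Longrightarrow> fiber_perms f A \<subseteq> fiber_perms f B"
  by (auto simp: fiber_perms_def intro: permutes_subset)

lemma fiber_permsI:
  assumes "p permutes B" "B \<subseteq> A" "\<And>x. x \<in> B \<Longrightarrow> f (p x) = f x"
  shows "p \<in> fiber_perms f A"
proof -
  have "f (p x) = f x" for x
    using assms(1,3) by (cases "x \<in> B") (auto simp: permutes_not_in)
  then show ?thesis
    using permutes_subset[OF assms(1,2)] by (simp add: fiber_perms_def)
qed

lemma sign_comp_permutes:
  "finite A \<Longrightarrow> p permutes A \<Longrightarrow> q permutes A \<Longrightarrow> sign (p \<circ> q) = sign p * sign q"
  by (intro sign_compose permutation_permutes[THEN iffD2]) blast+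

lemma permutes_inv_cancel:
  assumes "p permutes A"
  shows "p \<circ> (inv p \<circ> q) = q" "inv p \<circ> (p \<circ> q) = q" "q \<circ> p \<circ> inv p = q" "q \<circ> inv p \<circ> p = q"
  using assms by (auto simp: fun_eq_iff permutes_inverses)

lemma sum_fiber_perms_right:
  assumes "p \<in> fiber_perms f A"
  shows "(\<Sum>q\<in>fiber_perms f A. h (q \<circ> p)) = (\<Sum>q\<in>fiber_perms f A. h q)"
  by (rule sum.reindex_bij_witness[of _ "\<lambda>q. q \<circ> inv p" "\<lambda>q. q \<circ> p"])
    (use assms in \<open>auto simp: comp_in_fiber_perms inv_in_fiber_perms
        permutes_inv_cancel[OF fiber_perms_permutes]\<close>)

lemma sum_fiber_perms_left:
  assumes "p \<in> fiber_perms f A"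
  shows "(\<Sum>q\<in>fiber_perms f A. h (p \<circ> q)) = (\<Sum>q\<in>fiber_perms f A. h q)"
  by (rule sum.reindex_bij_witness[of _ "\<lambda>q. inv p \<circ> q" "\<lambda>q. p \<circ> q"])
    (use assms in \<open>auto simp: comp_in_fiber_perms inv_in_fiber_perms
        permutes_inv_cancel[OF fiber_perms_permutes]\<close>)

lemma sum_fiber_perms_inv:
  "(\<Sum>q\<in>fiber_perms f A. h (inv q)) = (\<Sum>q\<in>fiber_perms f A. h q)"
  by (rule sum.reindex_bij_witness[of _ inv inv])
    (auto simp: inv_in_fiber_perms permutes_inv_inv[OF fiber_perms_permutes])

lemma of_int_sign_square: "of_int (sign p) * of_int (sign p) = (1 :: 'k::ring_1)"
  by (simp add: sign_def)

text \<open>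
  A set of labels arranged in left-justified rows: \<open>r x\<close> and \<open>c x\<close> are the row and the column of
  the label \<open>x\<close>. Rows need not be consecutive nor weakly decreasing in length, because straightening
  only uses that every row meets all columns to the left of each of its labels.
\<close>

definition young_set :: "('a \<Rightarrow> nat) \<Rightarrow> ('a \<Rightarrow> nat) \<Rightarrow> 'a set \<Rightarrow> bool" where
  "young_set r c A \<longleftrightarrow> finite A \<and> inj_on (\<lambda>x. (r x, c x)) A \<and>
     (\<forall>x\<in>A. 1 \<le> c x \<and> (\<forall>j. 1 \<le> j \<and> j < c x \<longrightarrow> (\<exists>y\<in>A. r y = r x \<and> c y = j)))"

lemma row_col_perms_trivial:
  assumes "young_set r c A" "p \<in> fiber_perms r A" "p \<in> fiber_perms c A"
  shows "p = id"
proof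
  fix x
  have inj: "inj_on (\<lambda>x. (r x, c x)) A" and p: "p permutes A" "r (p x) = r x" "c (p x) = c x"
    using assms by (auto simp: young_set_def fiber_perms_def)
  show "p x = id x"
  proof (cases "x \<in> A")
    case True
    then have "p x \<in> A" using p(1) by (simp add: permutes_in_image)
    then show ?thesis using inj_onD[OF inj, of "p x" x] True p by simp
  next
    case False
    then show ?thesis using p(1) by (simp add: permutes_not_in)
  qed
qed

text \<open>The elementary step of the rearrangement inequality: the sums differ by (f b - f a) * (g
  a - g b). It makes the weight \<Psi> grow with every exchange.\<close>

lemma sum_mult_transpose_less:
  fixes f g :: "'a \<Rightarrow> nat"
  assumes "finite A" "a \<in> A" "b \<in> A" "f a < f b" "g b < g a"
  shows "(\<Sum>x\<in>A. f x * g x) < (\<Sum>x\<in>A. f x * g (transpose a b x))"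
proof -
  have ab: "a \<noteq> b" using assms by auto
  let ?B = "A - {a, b}"
  have split: "(\<Sum>x\<in>A. h x) = h a + h b + (\<Sum>x\<in>?B. h x)" for h :: "'a \<Rightarrow> nat"
  proof -
    have "A = insert a (insert b ?B)" using assms(2,3) by auto
    then have "(\<Sum>x\<in>A. h x) = (\<Sum>x\<in>insert a (insert b ?B). h x)" by simp
    also have "\<dots> = h a + h b + (\<Sum>x\<in>?B. h x)" using assms(1) ab by simp
    finally show ?thesis .
  qed
  have eq: "(\<Sum>x\<in>?B. f x * g (transpose a b x)) = (\<Sum>x\<in>?B. f x * g x)"
    by (rule sum.cong) (auto simp: transpose_def)
  obtain u where u: "f b = f a + u" "u > 0" using less_imp_add_positive[OF assms(4)] by metis
  obtain v where v: "g a = g b + v" "v > 0" using less_imp_add_positive[OF assms(5)] by metis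
  have "f a * g a + f b * g b < f a * g b + f b * g a"
    by (simp add: u v algebra_simps)
  then show ?thesis
    unfolding split[of "\<lambda>x. f x * g x"] split[of "\<lambda>x. f x * g (transpose a b x)"] eq
    by simp
qed

lemma sum_transpose_less:
  fixes g :: "'a \<Rightarrow> nat"
  assumes "finite P" "a \<in> P" "b \<notin> P" "g b < g a"
  shows "(\<Sum>x\<in>P. g (transpose a b x)) < (\<Sum>x\<in>P. g x)"
proof -
  have "(\<Sum>x\<in>P - {a}. g (transpose a b x)) = (\<Sum>x\<in>P - {a}. g x)"
    using assms by (intro sum.cong) (auto simp: transpose_def)
  then show ?thesis using assms by (simp add: sum.remove[of P a])
qed

lemma sum_permutes:
  "p permutes P \<Longrightarrow> (\<Sum>x\<in>P. g (p x)) = (\<Sum>x\<in>P. g x)"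
  using sum.permute[of p P g] by (simp add: comp_def)

lemma transpose_comp_cancel: "transpose a b \<circ> (transpose a b \<circ> h) = h"
  by (simp add: fun_eq_iff)

section \<open>Garnir relations\<close>

locale char_0_space = vector_space scale
  for scale :: "'k::field_char_0 \<Rightarrow> 'v::ab_group_add \<Rightarrow> 'v" (infixr "*s" 75)
begin

text \<open>
  The value under \<open>\<Phi>\<close>, extended linearly to the group algebra, of the Young symmetrizer of \<open>A\<close>
  times \<open>\<sigma>\<close>. Here \<open>\<sigma>\<close> is read as the rearrangement of \<open>A\<close> that puts the label \<open>b\<close> at the
  position originally occupied by \<open>\<sigma> b\<close>: composition on the left permutes positions, composition on
  the right permutes labels.
\<close>

definition ysum ::
  "('a \<Rightarrow> nat) \<Rightarrow> ('a \<Rightarrow> nat) \<Rightarrow> 'a set \<Rightarrow> (('a \<Rightarrow> 'a) \<Rightarrow> 'v) \<Rightarrow> ('a \<Rightarrow> 'a) \<Rightarrow> 'v" where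
  "ysum r c A \<Phi> \<sigma> =
     (\<Sum>p\<in>fiber_perms r A. \<Sum>q\<in>fiber_perms c A. of_int (sign q) *s \<Phi> (p \<circ> q \<circ> \<sigma>))"

lemma eq_uminus_imp_zero: "x = - x \<Longrightarrow> x = 0" for x :: 'v
proof -
  assume "x = - x"
  then have "x + x = 0" by (metis add.right_inverse)
  then have "(2::'k) *s x = 0" using scale_left_distrib[of 1 1 x] by simp
  then show ?thesis by simp
qed

text \<open>The column group is the factor next to \<sigma>, so \<tau> is absorbed by shifting the
  sum over \<open>q\<close>.\<close>

lemma ysum_col_left:
  assumes "finite A" and \<tau>: "\<tau> \<in> fiber_perms c A"
  shows "ysum r c A \<Phi> (\<tau> \<circ> \<sigma>) = of_int (sign \<tau>) *s ysum r c A \<Phi> \<sigma>"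
proof -
  have "(\<Sum>q\<in>fiber_perms c A. of_int (sign q) *s \<Phi> (p \<circ> q \<circ> (\<tau> \<circ> \<sigma>))) =
        of_int (sign \<tau>) *s (\<Sum>q\<in>fiber_perms c A. of_int (sign q) *s \<Phi> (p \<circ> q \<circ> \<sigma>))" for p
  proof -
    have "(\<Sum>q\<in>fiber_perms c A. of_int (sign q) *s \<Phi> (p \<circ> q \<circ> \<sigma>)) =
          (\<Sum>q\<in>fiber_perms c A. of_int (sign (q \<circ> \<tau>)) *s \<Phi> (p \<circ> (q \<circ> \<tau>) \<circ> \<sigma>))"
      by (rule sum_fiber_perms_right[OF \<tau>, symmetric])
    also have "\<dots> = of_int (sign \<tau>) *s
        (\<Sum>q\<in>fiber_perms c A. of_int (sign q) *s \<Phi> (p \<circ> q \<circ> (\<tau> \<circ> \<sigma>)))"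
      unfolding scale_sum_right
      by (rule sum.cong) (use \<tau> assms(1) in
        \<open>simp_all add: comp_assoc sign_comp_permutes[OF _ fiber_perms_permutes fiber_perms_permutes] mult.commute\<close>)
    finally show ?thesis by (simp add: of_int_sign_square)
  qed
  then show ?thesis by (simp add: ysum_def scale_sum_right)
qed

text \<open>Fix \<open>q\<close>. Rows are left-justified, so the row of each \<open>q x\<close>
  with \<open>x \<in> Z\<close> has a box in column \<open>j\<close>; as \<open>Z\<close> outnumbers
  that column, two elements of \<open>Z\<close> land in one row. Their transposition is absorbed by
  the row group but reverses the sign in the sum over \<open>Z\<close>, so the sum equals its
  negative.\<close>

lemma garnir:
  assumes A: "young_set r c A" and "Z \<subseteq> A" and j: "1 \<le> j" "j < j'"
    and Z: "\<And>x. x \<in> Z \<Longrightarrow> c x = j \<or> c x = j'"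
    and card: "card {x\<in>A. c x = j} < card Z"
  shows "(\<Sum>g | g permutes Z. of_int (sign g) *s ysum r c A \<Phi> (g \<circ> \<sigma>)) = 0"
proof -
  have fA: "finite A" and fZ: "finite Z"
    using A \<open>Z \<subseteq> A\<close> by (auto simp: young_set_def finite_subset)
  have inner: "(\<Sum>p\<in>fiber_perms r A. \<Sum>g | g permutes Z. of_int (sign g) *s \<Phi> (p \<circ> q \<circ> (g \<circ> \<sigma>))) = 0"
    (is "?X = 0") if q: "q \<in> fiber_perms c A" for q
  proof -
    have "\<exists>y\<in>A. r y = r (q x) \<and> c y = j" if "x \<in> Z" for x
    proof -
      have qx: "q x \<in> A" "c (q x) = c x"
        using q \<open>Z \<subseteq> A\<close> that by (auto simp: fiber_perms_def permutes_in_image)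
      show ?thesis
        using Z[OF that] qx A j unfolding young_set_def by metis
    qed
    then obtain y where y: "\<And>x. x \<in> Z \<Longrightarrow> y x \<in> A \<and> r (y x) = r (q x) \<and> c (y x) = j" by metis
    then have "y ` Z \<subseteq> {x\<in>A. c x = j}" by auto
    then have "card (y ` Z) < card Z"
      using card card_mono[of "{x\<in>A. c x = j}" "y ` Z"] fA by auto
    then obtain u v where uv: "u \<in> Z" "v \<in> Z" "u \<noteq> v" "y u = y v"
      using pigeonhole unfolding inj_on_def by blast
    let ?t = "transpose u v" and ?s = "transpose (q u) (q v)"
    have qp: "q permutes A" using q by (rule fiber_perms_permutes)
    have s: "?s \<in> fiber_perms r A"
      using uv y \<open>Z \<subseteq> A\<close> qp by (intro transpose_in_fiber_perms) (auto simp: permutes_in_image, metis)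
    have sq: "?s \<circ> q = q \<circ> ?t"
      using permutes_inj[OF qp] by (auto simp: fun_eq_iff transpose_def inj_eq)
    have t: "?t permutes Z" using uv by (simp add: permutes_swap_id)
    have "?X = (\<Sum>p\<in>fiber_perms r A. \<Sum>g | g permutes Z. of_int (sign g) *s \<Phi> (p \<circ> ?s \<circ> q \<circ> (g \<circ> \<sigma>)))"
      using sum_fiber_perms_right[OF s, symmetric, of "\<lambda>p. \<Sum>g | g permutes Z. of_int (sign g) *s \<Phi> (p \<circ> q \<circ> (g \<circ> \<sigma>))"] .
    also have "\<dots> = (\<Sum>p\<in>fiber_perms r A. \<Sum>g | g permutes Z. of_int (sign g) *s \<Phi> (p \<circ> q \<circ> (?t \<circ> g \<circ> \<sigma>)))"
    proof -
      have "p \<circ> ?s \<circ> q \<circ> (g \<circ> \<sigma>) = p \<circ> q \<circ> (?t \<circ> g \<circ> \<sigma>)" for p g :: "'a \<Rightarrow> 'a"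
        using fun_cong[OF sq] by (simp add: fun_eq_iff)
      then show ?thesis by simp
    qed
    also have "\<dots> = (\<Sum>p\<in>fiber_perms r A. - (\<Sum>g | g permutes Z. of_int (sign g) *s \<Phi> (p \<circ> q \<circ> (g \<circ> \<sigma>))))"
    proof (rule sum.cong[OF refl])
      fix p
      have "(\<Sum>g | g permutes Z. of_int (sign g) *s \<Phi> (p \<circ> q \<circ> (g \<circ> \<sigma>))) =
         (\<Sum>g | g permutes Z. of_int (sign (?t \<circ> g)) *s \<Phi> (p \<circ> q \<circ> (?t \<circ> g \<circ> \<sigma>)))"
        by (rule sum.reindex_bij_witness[of _ "\<lambda>g. ?t \<circ> g" "\<lambda>g. ?t \<circ> g"])
          (use t in \<open>auto simp: permutes_compose simp flip: comp_assoc\<close>)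
      also have "\<dots> = - (\<Sum>g | g permutes Z. of_int (sign g) *s \<Phi> (p \<circ> q \<circ> (?t \<circ> g \<circ> \<sigma>)))"
        unfolding sum_negf[symmetric]
        by (rule sum.cong) (use t fZ uv in \<open>auto simp: sign_comp_permutes sign_swap_id\<close>)
      finally show "(\<Sum>g | g permutes Z. of_int (sign g) *s \<Phi> (p \<circ> q \<circ> (?t \<circ> g \<circ> \<sigma>))) =
         - (\<Sum>g | g permutes Z. of_int (sign g) *s \<Phi> (p \<circ> q \<circ> (g \<circ> \<sigma>)))" by simp
    qed
    also have "\<dots> = - ?X" by (simp add: sum_negf)
    finally show ?thesis by (rule eq_uminus_imp_zero)
  qed
  have "(\<Sum>g | g permutes Z. of_int (sign g) *s ysum r c A \<Phi> (g \<circ> \<sigma>)) =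
    (\<Sum>g | g permutes Z. \<Sum>q\<in>fiber_perms c A. \<Sum>p\<in>fiber_perms r A.
        of_int (sign q) *s of_int (sign g) *s \<Phi> (p \<circ> q \<circ> (g \<circ> \<sigma>)))"
    unfolding ysum_def
    by (intro sum.cong refl, subst sum.swap) (simp add: scale_sum_right mult.commute)
  also have "\<dots> = (\<Sum>q\<in>fiber_perms c A. of_int (sign q) *s
      (\<Sum>p\<in>fiber_perms r A. \<Sum>g | g permutes Z. of_int (sign g) *s \<Phi> (p \<circ> q \<circ> (g \<circ> \<sigma>))))"
    unfolding scale_sum_right
    by (rule trans[OF sum.swap]) (rule sum.cong[OF refl], rule sum.swap)
  also have "\<dots> = 0" by (simp add: inner)
  finally show ?thesis .
qed

text \<open>The Garnir relation for column \<open>j\<close> together with \<open>x\<close>. The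
  permutations of this set fall into cosets of those of column \<open>j\<close>, each represented by
  some \<open>transpose x y\<close>. Within a coset all terms agree, because the signs cancel; after
  division by the coset size, the identity has sign 1 and every other representative sign
  -1.\<close>

lemma exchange:
  assumes A: "young_set r c A" and x: "x \<in> A" and j: "1 \<le> j" "j < c x"
  shows "ysum r c A \<Phi> \<sigma> = (\<Sum>y | y \<in> A \<and> c y = j. ysum r c A \<Phi> (transpose x y \<circ> \<sigma>))"
proof -
  let ?C = "{y\<in>A. c y = j}"
  have fA: "finite A" using A by (simp add: young_set_def)
  have xC: "x \<notin> ?C" using j by auto
  have fC: "finite ?C" using fA by simp
  have "0 = (\<Sum>g | g permutes insert x ?C. of_int (sign g) *s ysum r c A \<Phi> (g \<circ> \<sigma>))"
    by (rule garnir[OF A _ j, symmetric]) (use x xC fC in auto)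
  also have "\<dots> = (\<Sum>(y, \<tau>)\<in>insert x ?C \<times> {\<tau>. \<tau> permutes ?C}.
      of_int (sign (\<tau> \<circ> transpose x y)) *s ysum r c A \<Phi> (\<tau> \<circ> transpose x y \<circ> \<sigma>))"
  \<comment> \<open>In \<open>g = \<tau> \<circ> transpose x y\<close> the factor \<tau> fixes
    \<open>x\<close>, so \<open>g y = x\<close>; this recovers \<open>y\<close> as
    \<open>inv g x\<close>.\<close>
  proof (rule sum.reindex_bij_witness[of _ "\<lambda>(y, \<tau>). \<tau> \<circ> transpose x y"
        "\<lambda>g. (inv g x, g \<circ> transpose x (inv g x))"], goal_cases)
    case (1 g)
    then show ?case by (simp add: comp_assoc transpose_comp_cancel)
  next
    case (2 g)
    then have g: "g permutes insert x ?C" by simp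
    then have y: "inv g x \<in> insert x ?C" using permutes_in_image[OF permutes_inv[OF g]] by simp
    have "g \<circ> transpose x (inv g x) permutes insert x ?C"
      using y by (intro permutes_compose g permutes_swap_id) auto
    then have "g \<circ> transpose x (inv g x) permutes ?C"
      by (rule permutes_superset) (auto simp: permutes_inverses[OF g])
    with y show ?case by simp
  next
    case (3 b)
    then obtain y \<tau> where b: "b = (y, \<tau>)" "y \<in> insert x ?C" "\<tau> permutes ?C" by auto
    have "\<tau> x = x" using b(3) xC by (rule permutes_not_in)
    moreover have "\<tau> \<circ> transpose x y permutes insert x ?C"
      using b by (intro permutes_compose permutes_swap_id permutes_subset[OF b(3)]) auto
    ultimately have "inv (\<tau> \<circ> transpose x y) x = y"
      by (simp add: permutes_inv_eq)
    then show ?case using b by (simp add: comp_assoc)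
  next
    case (4 b)
    then obtain y \<tau> where b: "b = (y, \<tau>)" "y \<in> insert x ?C" "\<tau> permutes ?C" by auto
    have "\<tau> \<circ> transpose x y permutes insert x ?C"
      using b by (intro permutes_compose permutes_swap_id permutes_subset[OF b(3)]) auto
    then show ?case using b by simp
  next
    case (5 g)
    then show ?case by (simp add: comp_assoc transpose_comp_cancel)
  qed
  also have "\<dots> = (\<Sum>(y, \<tau>)\<in>insert x ?C \<times> {\<tau>. \<tau> permutes ?C}.
      of_int (sign (transpose x y)) *s ysum r c A \<Phi> (transpose x y \<circ> \<sigma>))"
  proof (rule sum.cong[OF refl], clarify)
    fix y \<tau> assume y: "y \<in> insert x ?C" and \<tau>: "\<tau> permutes ?C"
    have \<tau>A: "\<tau> \<in> fiber_perms c A"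
    proof (rule fiber_permsI[OF \<tau>])
      show "c (\<tau> a) = c a" if "a \<in> ?C" for a
        using that permutes_in_image[OF \<tau>, of a] by auto
    qed auto
    have tA: "transpose x y permutes A" using x y by (auto intro: permutes_swap_id)
    have "sign (\<tau> \<circ> transpose x y) = sign \<tau> * sign (transpose x y)"
      by (rule sign_comp_permutes[OF fA fiber_perms_permutes[OF \<tau>A] tA])
    then show "of_int (sign (\<tau> \<circ> transpose x y)) *s ysum r c A \<Phi> (\<tau> \<circ> transpose x y \<circ> \<sigma>) =
          of_int (sign (transpose x y)) *s ysum r c A \<Phi> (transpose x y \<circ> \<sigma>)"
      unfolding comp_assoc ysum_col_left[OF fA \<tau>A]
      by (simp add: algebra_simps) (simp add: of_int_sign_square flip: mult.assoc)
  qed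
  also have "\<dots> = of_nat (card {\<tau>. \<tau> permutes ?C}) *s
      (\<Sum>y\<in>insert x ?C. of_int (sign (transpose x y)) *s ysum r c A \<Phi> (transpose x y \<circ> \<sigma>))"
    by (simp add: sum.cartesian_product[symmetric] sum_constant_scale scale_sum_right del: scale_scale)
  finally have "(\<Sum>y\<in>insert x ?C. of_int (sign (transpose x y)) *s ysum r c A \<Phi> (transpose x y \<circ> \<sigma>)) = 0"
    using fC by (simp add: card_permutations[OF refl fC] eq_commute[of 0])
  moreover have "(\<Sum>y\<in>?C. of_int (sign (transpose x y)) *s ysum r c A \<Phi> (transpose x y \<circ> \<sigma>)) =
     - (\<Sum>y\<in>?C. ysum r c A \<Phi> (transpose x y \<circ> \<sigma>))"
    unfolding sum_negf[symmetric] by (rule sum.cong) (use j in \<open>auto simp: sign_swap_id\<close>)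
  ultimately show ?thesis
    using fC xC by simp
qed

end

section \<open>Straightening small labels to the left\<close>

text \<open>Here \<open>c b\<close> is the original column of \<open>b\<close> and
  \<open>c (\<sigma> b)\<close> the current one. For \<open>w\<close> equal to the original column
  sum of \<open>P\<close>, the strict bound says that some label has moved left.\<close>

definition lowered :: "('a \<Rightarrow> nat) \<Rightarrow> 'a set \<Rightarrow> nat \<Rightarrow> 'a set \<Rightarrow> ('a \<Rightarrow> 'a) set" where
  "lowered c P w A =
     {\<sigma>. \<sigma> permutes A \<and> (\<forall>b\<in>P. c (\<sigma> b) \<le> c b) \<and> (\<Sum>b\<in>P. c (\<sigma> b)) < w}"

lemma lowered_mono: "w \<le> w' \<Longrightarrow> lowered c P w A \<subseteq> lowered c P w' A"
  by (auto simp: lowered_def)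

lemma obtain_minimal_raised:
  fixes c :: "'a \<Rightarrow> nat"
  assumes "\<not> (\<forall>b\<in>P. c (\<sigma> b) \<le> c b)"
  obtains b where "b \<in> P" "c b < c (\<sigma> b)" "\<And>a. a \<in> P \<Longrightarrow> c a < c (\<sigma> a) \<Longrightarrow> c b \<le> c a"
proof -
  from assms obtain b0 where "b0 \<in> P \<and> c b0 < c (\<sigma> b0)"
    by (meson not_le)
  from ex_has_least_nat[of "\<lambda>b. b \<in> P \<and> c b < c (\<sigma> b)", OF this, of c] that
  show ?thesis by blast
qed

lemma sum_comp_transpose_le:
  fixes c :: "'a \<Rightarrow> nat"
  assumes "finite P" "b \<in> P" "c (\<sigma> a) < c (\<sigma> b)"
  shows "(\<Sum>x\<in>P. c ((\<sigma> \<circ> transpose b a) x)) \<le> (\<Sum>x\<in>P. c (\<sigma> x))"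
    and "a \<notin> P \<Longrightarrow> (\<Sum>x\<in>P. c ((\<sigma> \<circ> transpose b a) x)) < (\<Sum>x\<in>P. c (\<sigma> x))"
proof -
  show less: "(\<Sum>x\<in>P. c ((\<sigma> \<circ> transpose b a) x)) < (\<Sum>x\<in>P. c (\<sigma> x))" if "a \<notin> P"
    using sum_transpose_less[of P b a "c \<circ> \<sigma>"] assms that by simp
  show "(\<Sum>x\<in>P. c ((\<sigma> \<circ> transpose b a) x)) \<le> (\<Sum>x\<in>P. c (\<sigma> x))"
  proof (cases "a \<in> P")
    case True
    then have "transpose b a permutes P" using assms(2) by (simp add: permutes_swap_id)
    from sum_permutes[OF this, of "c \<circ> \<sigma>"] show ?thesis by simp
  qed (use less in simp)
qed

context char_0_space
begin

lemma span_scale_cancel: "a *s x \<in> span S \<Longrightarrow> a \<noteq> 0 \<Longrightarrow> x \<in> span S"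
  using span_scale[of "a *s x" S "inverse a"] by simp

text \<open>The value of \<Phi> at the Young symmetrizer of \<open>A\<close> times \<sigma> times
  the column antisymmetrizer of \<open>P\<close>. The factor \<open>h\<close> permutes labels with
  the same original column, wherever \<sigma> has put them. Summing over the row group of
  \<open>P\<close> in place of \<sigma> yields \<open>c(T) c(S)\<close>.\<close>

definition alt_ysum ::
  "('a \<Rightarrow> nat) \<Rightarrow> ('a \<Rightarrow> nat) \<Rightarrow> 'a set \<Rightarrow> 'a set \<Rightarrow> (('a \<Rightarrow> 'a) \<Rightarrow> 'v) \<Rightarrow> ('a \<Rightarrow> 'a) \<Rightarrow> 'v" where
  "alt_ysum r c A P \<Phi> \<sigma> =
     (\<Sum>h\<in>fiber_perms c P. of_int (sign h) *s ysum r c A \<Phi> (\<sigma> \<circ> h))"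

lemma alt_ysum_col_right:
  assumes "finite P" and \<tau>: "\<tau> \<in> fiber_perms c P"
  shows "alt_ysum r c A P \<Phi> (\<sigma> \<circ> \<tau>) = of_int (sign \<tau>) *s alt_ysum r c A P \<Phi> \<sigma>"
proof -
  have "alt_ysum r c A P \<Phi> \<sigma> =
      (\<Sum>h\<in>fiber_perms c P. of_int (sign (\<tau> \<circ> h)) *s ysum r c A \<Phi> (\<sigma> \<circ> (\<tau> \<circ> h)))"
    unfolding alt_ysum_def by (rule sum_fiber_perms_left[OF \<tau>, symmetric])
  also have "\<dots> = of_int (sign \<tau>) *s alt_ysum r c A P \<Phi> (\<sigma> \<circ> \<tau>)"
    unfolding alt_ysum_def scale_sum_right
    by (rule sum.cong) (use \<tau> assms(1) in
        \<open>simp_all add: comp_assoc sign_comp_permutes[OF _ fiber_perms_permutes fiber_perms_permutes]\<close>)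
  finally show ?thesis by (simp add: of_int_sign_square)
qed

lemma alt_ysum_id:
  assumes "finite A" "P \<subseteq> A"
  shows "alt_ysum r c A P \<Phi> id = of_nat (card (fiber_perms c P)) *s ysum r c A \<Phi> id"
proof -
  have "of_int (sign h) *s ysum r c A \<Phi> (id \<circ> h) = ysum r c A \<Phi> id" if "h \<in> fiber_perms c P" for h
    using ysum_col_left[of A h c r \<Phi> id] that assms fiber_perms_mono[OF assms(2), of c]
    by (auto simp: of_int_sign_square)
  then show ?thesis by (simp add: alt_ysum_def sum_constant_scale)
qed

text \<open>The label \<open>b\<close>, too far right, is exchanged with the labels now in its
  original column. For a partner in \<open>N\<close> this is a column permutation of
  \<open>P\<close> and yields the negative of the original value; moving these \<open>card N\<close>
  terms to the other side produces the factor \<open>Suc (card N)\<close>.\<close>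

lemma alt_exchange:
  assumes A: "young_set r c A" and "P \<subseteq> A" and \<sigma>: "\<sigma> permutes A"
    and b: "b \<in> P" "1 \<le> c b" "c b < c (\<sigma> b)"
  defines "N \<equiv> {a\<in>P. c a = c b \<and> c (\<sigma> a) = c b}"
  shows "of_nat (Suc (card N)) *s alt_ysum r c A P \<Phi> \<sigma> =
    (\<Sum>a\<in>{a\<in>A. c (\<sigma> a) = c b} - N. alt_ysum r c A P \<Phi> (\<sigma> \<circ> transpose b a))"
proof -
  have fA: "finite A" and fP: "finite P"
    using A \<open>P \<subseteq> A\<close> by (auto simp: young_set_def finite_subset)
  have \<sigma>b: "\<sigma> b \<in> A" using b \<open>P \<subseteq> A\<close> \<sigma> by (auto simp: permutes_in_image)
  have "alt_ysum r c A P \<Phi> \<sigma> =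
      (\<Sum>y | y \<in> A \<and> c y = c b. alt_ysum r c A P \<Phi> (transpose (\<sigma> b) y \<circ> \<sigma>))"
  proof -
    have "of_int (sign h) *s ysum r c A \<Phi> (\<sigma> \<circ> h) = (\<Sum>y | y \<in> A \<and> c y = c b.
        of_int (sign h) *s ysum r c A \<Phi> (transpose (\<sigma> b) y \<circ> \<sigma> \<circ> h))" for h
      unfolding comp_assoc scale_sum_right[symmetric]
      by (rule arg_cong[OF exchange[OF A \<sigma>b b(2,3)]])
    then show ?thesis unfolding alt_ysum_def by (subst sum.swap) simp
  qed
  also have "\<dots> = (\<Sum>a | a \<in> A \<and> c (\<sigma> a) = c b. alt_ysum r c A P \<Phi> (\<sigma> \<circ> transpose b a))"
  proof (rule sum.reindex_bij_witness[of _ \<sigma> "inv \<sigma>"], goal_cases)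
    case (5 y)
    \<comment> \<open>Conjugation by \<sigma> turns an exchange of positions into one of the labels
      standing there.\<close>
    have "transpose (\<sigma> b) y \<circ> \<sigma> = \<sigma> \<circ> transpose b (inv \<sigma> y)"
      using permutes_inj[OF \<sigma>] permutes_inverses[OF \<sigma>]
      by (auto simp: fun_eq_iff transpose_def inj_eq)
    then show ?case by simp
  qed (use \<sigma> in \<open>auto simp: permutes_inverses permutes_in_image[OF permutes_inv[OF \<sigma>]] permutes_in_image\<close>)
  also have "{a \<in> A. c (\<sigma> a) = c b} = ({a\<in>A. c (\<sigma> a) = c b} - N) \<union> N"
    using \<open>P \<subseteq> A\<close> by (auto simp: N_def)
  also have "(\<Sum>a\<in>\<dots>. alt_ysum r c A P \<Phi> (\<sigma> \<circ> transpose b a)) =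
     (\<Sum>a\<in>{a\<in>A. c (\<sigma> a) = c b} - N. alt_ysum r c A P \<Phi> (\<sigma> \<circ> transpose b a)) +
     (\<Sum>a\<in>N. alt_ysum r c A P \<Phi> (\<sigma> \<circ> transpose b a))"
    by (rule sum.union_disjoint) (use fA fP in \<open>auto simp: N_def\<close>)
  also have "(\<Sum>a\<in>N. alt_ysum r c A P \<Phi> (\<sigma> \<circ> transpose b a)) =
      (\<Sum>a\<in>N. - alt_ysum r c A P \<Phi> \<sigma>)"
  proof (rule sum.cong[OF refl])
    fix a assume a: "a \<in> N"
    then have "transpose b a \<in> fiber_perms c P" "b \<noteq> a"
      using b by (auto simp: N_def intro!: transpose_in_fiber_perms)
    then show "alt_ysum r c A P \<Phi> (\<sigma> \<circ> transpose b a) = - alt_ysum r c A P \<Phi> \<sigma>"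
      by (simp add: alt_ysum_col_right[OF fP] sign_swap_id)
  qed
  finally have "alt_ysum r c A P \<Phi> \<sigma> + of_nat (card N) *s alt_ysum r c A P \<Phi> \<sigma> =
      (\<Sum>a\<in>{a\<in>A. c (\<sigma> a) = c b} - N. alt_ysum r c A P \<Phi> (\<sigma> \<circ> transpose b a))"
    by (simp add: sum_negf sum_constant_scale eq_diff_eq comp_def)
  then show ?thesis by (simp only: of_nat_Suc scale_left_distrib scale_one)
qed

text \<open>
  A label \<open>b \<in> P\<close> lying to the right of its original column \<open>j\<close> is exchanged with the column \<open>j\<close>;
  exchanges with labels originally from column \<open>j\<close> only rescale, by antisymmetry. If the original
  column of \<open>b\<close> is the least possible, all other exchange partners come from columns further right,
  so that \<open>\<Psi>\<close>, in which labels outside \<open>P\<close> get a large weight, increases.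
\<close>

lemma alt_ysum_straighten:
  assumes A: "young_set r c A" and "P \<subseteq> A" and "\<sigma> permutes A"
  shows "alt_ysum r c A P \<Phi> \<sigma> \<in>
    span (ysum r c A \<Phi> ` lowered c P (Suc (\<Sum>b\<in>P. c (\<sigma> b))) A)"
proof -
  define l where "l a = (if a \<in> P then c a else Suc (\<Sum>x\<in>A. c x))" for a
  define \<Psi> where "\<Psi> \<sigma> = (\<Sum>a\<in>A. l a * c (\<sigma> a))" for \<sigma>
  define M where "M = (\<Sum>a\<in>A. l a * (\<Sum>x\<in>A. c x))"
  have fA: "finite A" and fP: "finite P"
    using A \<open>P \<subseteq> A\<close> by (auto simp: young_set_def finite_subset)
  have c_le: "c x \<le> (\<Sum>x\<in>A. c x)" if "x \<in> A" for x
    using that fA by (intro member_le_sum) auto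
  have \<Psi>_le: "\<Psi> \<sigma> \<le> M" if "\<sigma> permutes A" for \<sigma>
    unfolding \<Psi>_def M_def by (intro sum_mono mult_le_mono2 c_le) (simp add: that permutes_in_image)
  show ?thesis using assms(3)
  proof (induction "M - \<Psi> \<sigma>" arbitrary: \<sigma> rule: less_induct)
    case less
    note \<sigma> = less.prems
    show ?case
    proof (cases "\<forall>b\<in>P. c (\<sigma> b) \<le> c b")
      case True
      \<comment> \<open>Expanding the antisymmetrizer is now harmless: \<open>h\<close> only
        permutes labels with the same original column, which keeps both conditions.\<close>
      have "\<sigma> \<circ> h \<in> lowered c P (Suc (\<Sum>b\<in>P. c (\<sigma> b))) A" if h: "h \<in> fiber_perms c P" for h
      proof -
        have hP: "h permutes P" and hc: "c (h x) = c x" for x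
          using h by (auto simp: fiber_perms_def)
        have "c (\<sigma> (h b)) \<le> c b" if "b \<in> P" for b
          using True[rule_format, of "h b"] that by (simp add: hc permutes_in_image[OF hP])
        then show ?thesis
          using sum_permutes[OF hP, of "c \<circ> \<sigma>"] permutes_compose[OF permutes_subset[OF hP \<open>P \<subseteq> A\<close>] \<sigma>]
          by (simp add: lowered_def)
      qed
      then show ?thesis
        unfolding alt_ysum_def by (intro span_sum span_scale span_base) auto
    next
      case False
      then obtain b where b: "b \<in> P" "c b < c (\<sigma> b)"
        and min: "\<And>a. a \<in> P \<Longrightarrow> c a < c (\<sigma> a) \<Longrightarrow> c b \<le> c a"
        by (rule obtain_minimal_raised) blast
      have b1: "1 \<le> c b" using A b \<open>P \<subseteq> A\<close> by (auto simp: young_set_def)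
      let ?N = "{a\<in>P. c a = c b \<and> c (\<sigma> a) = c b}"
      have "alt_ysum r c A P \<Phi> (\<sigma> \<circ> transpose b a) \<in>
          span (ysum r c A \<Phi> ` lowered c P (Suc (\<Sum>b\<in>P. c (\<sigma> b))) A)"
        if a: "a \<in> {a\<in>A. c (\<sigma> a) = c b} - ?N" for a
      proof -
        have bA: "b \<in> A" using b \<open>P \<subseteq> A\<close> by auto
        have less_a: "c (\<sigma> a) < c (\<sigma> b)" using a b by simp
        have "\<not> c a < c b" if "a \<in> P" using a min[OF that] by auto
        then have "l b < l a"
          using a b c_le[OF bA] by (auto simp: l_def)
        then have "\<Psi> \<sigma> < \<Psi> (\<sigma> \<circ> transpose b a)"
          using sum_mult_transpose_less[OF fA bA, of a l "c \<circ> \<sigma>"] a less_a by (simp add: \<Psi>_def)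
        moreover have perm: "\<sigma> \<circ> transpose b a permutes A"
          using a bA by (intro permutes_compose[OF _ \<sigma>] permutes_swap_id) auto
        ultimately have "M - \<Psi> (\<sigma> \<circ> transpose b a) < M - \<Psi> \<sigma>"
          using \<Psi>_le[OF perm] by simp
        \<comment> \<open>The exchange does not raise the column sum of \<open>P\<close>, so the
          bound from the induction hypothesis is at least as strong as the required one.\<close>
        from less.hyps[OF this perm] show ?thesis
          by (rule rev_subsetD) (intro span_mono image_mono lowered_mono Suc_le_mono[THEN iffD2]
              sum_comp_transpose_le(1)[where \<sigma> = \<sigma> and c = c, OF fP b(1) less_a])
      qed
      then have "of_nat (Suc (card ?N)) *s alt_ysum r c A P \<Phi> \<sigma> \<in>
          span (ysum r c A \<Phi> ` lowered c P (Suc (\<Sum>b\<in>P. c (\<sigma> b))) A)"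
        unfolding alt_exchange[OF A \<open>P \<subseteq> A\<close> \<sigma> b(1) b1 b(2)] by (rule span_sum)
      then show ?thesis by (rule span_scale_cancel[OF _ of_nat_neq_0])
    qed
  qed
qed

text \<open>
  The coefficient \<open>\<gamma>\<close> does not depend on \<open>A\<close>: the exchanges inside \<open>P\<close> are the same for all \<open>A\<close>,
  and those with labels outside \<open>P\<close> contribute to the span only.
\<close>

lemma alt_ysum_leading_coeff:
  assumes P: "young_set r c P" and "\<sigma> permutes P"
  shows "\<exists>\<gamma>. \<forall>A \<Phi>. young_set r c A \<and> P \<subseteq> A \<longrightarrow>
    alt_ysum r c A P \<Phi> \<sigma> - \<gamma> *s ysum r c A \<Phi> id \<in>
      span (ysum r c A \<Phi> ` lowered c P (\<Sum>b\<in>P. c b) A)"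
proof -
  define \<Psi> where "\<Psi> \<sigma> = (\<Sum>a\<in>P. c a * c (\<sigma> a))" for \<sigma>
  define M where "M = (\<Sum>a\<in>P. c a * (\<Sum>x\<in>P. c x))"
  have fP: "finite P" using P by (simp add: young_set_def)
  have c_le: "c x \<le> (\<Sum>x\<in>P. c x)" if "x \<in> P" for x
    using that fP by (intro member_le_sum) auto
  have \<Psi>_le: "\<Psi> \<sigma> \<le> M" if "\<sigma> permutes P" for \<sigma>
    unfolding \<Psi>_def M_def by (intro sum_mono mult_le_mono2 c_le) (simp add: that permutes_in_image)
  show ?thesis using assms(2)
  proof (induction "M - \<Psi> \<sigma>" arbitrary: \<sigma> rule: less_induct)
    case less
    note \<sigma> = less.prems
    show ?case
    proof (cases "\<forall>b\<in>P. c (\<sigma> b) \<le> c b")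
      case True
      \<comment> \<open>As \<sigma> permutes \<open>P\<close>, the column sum is the original one;
        with no label moved right, every label is still in its column.\<close>
      have "c (\<sigma> b) = c b" if "b \<in> P" for b
        using sum_mono_inv[OF sum_permutes[OF \<sigma>, of c]] True fP that by auto
      then have \<sigma>c: "\<sigma> \<in> fiber_perms c P" by (intro fiber_permsI[OF \<sigma>]) auto
      have "alt_ysum r c A P \<Phi> \<sigma> = (of_int (sign \<sigma>) * of_nat (card (fiber_perms c P))) *s ysum r c A \<Phi> id"
        if "young_set r c A" "P \<subseteq> A" for A \<Phi>
        using alt_ysum_col_right[OF fP \<sigma>c, of r A \<Phi> id] alt_ysum_id[of A P r c \<Phi>] that
        by (simp add: young_set_def)
      then show ?thesis by (metis diff_self span_zero)
    next
      case False
      then obtain b where b: "b \<in> P" "c b < c (\<sigma> b)"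
        and min: "\<And>a. a \<in> P \<Longrightarrow> c a < c (\<sigma> a) \<Longrightarrow> c b \<le> c a"
        by (rule obtain_minimal_raised) blast
      have b1: "1 \<le> c b" using P b by (auto simp: young_set_def)
      let ?N = "{a\<in>P. c a = c b \<and> c (\<sigma> a) = c b}"
      let ?Q = "{a\<in>P. c (\<sigma> a) = c b} - ?N"
      have "\<exists>\<gamma>. \<forall>A \<Phi>. young_set r c A \<and> P \<subseteq> A \<longrightarrow>
          alt_ysum r c A P \<Phi> (\<sigma> \<circ> transpose b a) - \<gamma> *s ysum r c A \<Phi> id \<in>
          span (ysum r c A \<Phi> ` lowered c P (\<Sum>b\<in>P. c b) A)" if a: "a \<in> ?Q" for a
      proof (rule less.hyps)
        have "\<not> c a < c b" using a min[of a] by auto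
        then have "c b < c a" using a by auto
        then have "\<Psi> \<sigma> < \<Psi> (\<sigma> \<circ> transpose b a)"
          using sum_mult_transpose_less[OF fP b(1), of a c "c \<circ> \<sigma>"] a b(2) by (simp add: \<Psi>_def)
        moreover show perm: "\<sigma> \<circ> transpose b a permutes P"
          using a b by (intro permutes_compose[OF _ \<sigma>] permutes_swap_id) auto
        ultimately show "M - \<Psi> (\<sigma> \<circ> transpose b a) < M - \<Psi> \<sigma>"
          using \<Psi>_le[OF perm] by simp
      qed
      then have "\<forall>a\<in>?Q. \<exists>\<gamma>. \<forall>A \<Phi>. young_set r c A \<and> P \<subseteq> A \<longrightarrow>
          alt_ysum r c A P \<Phi> (\<sigma> \<circ> transpose b a) - \<gamma> *s ysum r c A \<Phi> id \<in>
          span (ysum r c A \<Phi> ` lowered c P (\<Sum>b\<in>P. c b) A)" by (rule ballI)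
      from bchoice[OF this] obtain g where g: "\<forall>a\<in>?Q. \<forall>A \<Phi>. young_set r c A \<and> P \<subseteq> A \<longrightarrow>
          alt_ysum r c A P \<Phi> (\<sigma> \<circ> transpose b a) - g a *s ysum r c A \<Phi> id \<in>
          span (ysum r c A \<Phi> ` lowered c P (\<Sum>b\<in>P. c b) A)" by (rule exE)
      define n :: 'k where "n = of_nat (Suc (card ?N))"
      have n: "n \<noteq> 0" unfolding n_def by (rule of_nat_neq_0)
      have "alt_ysum r c A P \<Phi> \<sigma> - ((\<Sum>a\<in>?Q. g a) / n) *s ysum r c A \<Phi> id \<in>
          span (ysum r c A \<Phi> ` lowered c P (\<Sum>b\<in>P. c b) A)" (is "?d \<in> span ?L")
        if A: "young_set r c A" and PA: "P \<subseteq> A" for A \<Phi>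
      proof -
        \<comment> \<open>Partners outside \<open>P\<close>. Since \<sigma> permutes
          \<open>P\<close>, the column sum of \<open>P\<close> is still the original one, and an
          exchange with a label that does not count lowers it strictly. Hence these terms lie in the
          span.\<close>
        let ?B = "{a\<in>A - P. c (\<sigma> a) = c b}"
        have fA: "finite A" using A by (simp add: young_set_def)
        have \<sigma>A: "\<sigma> permutes A" by (rule permutes_subset[OF \<sigma> PA])
        have B: "alt_ysum r c A P \<Phi> (\<sigma> \<circ> transpose b a) \<in> span ?L" if a: "a \<in> ?B" for a
        proof -
          have less_a: "c (\<sigma> a) < c (\<sigma> b)" using a b by simp
          have "\<sigma> \<circ> transpose b a permutes A"
            using a b PA by (intro permutes_compose[OF _ \<sigma>A] permutes_swap_id) auto
          from alt_ysum_straighten[OF A PA this] show ?thesis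
          proof (rule rev_subsetD, intro span_mono image_mono lowered_mono)
            show "Suc (\<Sum>x\<in>P. c ((\<sigma> \<circ> transpose b a) x)) \<le> (\<Sum>x\<in>P. c x)"
              using sum_comp_transpose_le(2)[where \<sigma> = \<sigma> and c = c, OF fP b(1) less_a] a
                sum_permutes[OF \<sigma>, of c] by auto
          qed
        qed
        have "n *s alt_ysum r c A P \<Phi> \<sigma> =
            (\<Sum>a\<in>{a\<in>A. c (\<sigma> a) = c b} - ?N. alt_ysum r c A P \<Phi> (\<sigma> \<circ> transpose b a))"
          unfolding n_def by (rule alt_exchange[OF A PA \<sigma>A b(1) b1 b(2)])
        also have "{a\<in>A. c (\<sigma> a) = c b} - ?N = ?Q \<union> ?B" using PA by auto
        also have "(\<Sum>a\<in>\<dots>. alt_ysum r c A P \<Phi> (\<sigma> \<circ> transpose b a)) =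
           (\<Sum>a\<in>?Q. alt_ysum r c A P \<Phi> (\<sigma> \<circ> transpose b a)) +
           (\<Sum>a\<in>?B. alt_ysum r c A P \<Phi> (\<sigma> \<circ> transpose b a))"
          by (rule sum.union_disjoint) (use fA fP in auto)
        finally have "n *s ?d =
           (\<Sum>a\<in>?Q. alt_ysum r c A P \<Phi> (\<sigma> \<circ> transpose b a) - g a *s ysum r c A \<Phi> id) +
           (\<Sum>a\<in>?B. alt_ysum r c A P \<Phi> (\<sigma> \<circ> transpose b a))"
          using n by (simp add: scale_right_diff_distrib sum_subtractf scale_sum_left)
        also have "\<dots> \<in> span ?L"
          using g A PA by (intro span_add span_sum B) blast+
        finally show ?thesis using n by (rule span_scale_cancel)
      qed
      then show ?thesis by blast
    qed
  qed
qed

end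

section \<open>The leading coefficient and the shape of the small region\<close>

text \<open>
  With \<open>a\<close> and \<open>b\<close> the row symmetrizer and column antisymmetrizer of \<open>P\<close>, the sum is, up to a
  positive factor, the coefficient of the identity in \<open>(b a b)\<^sup>2\<close>. As \<open>b a b\<close> is invariant under
  inversion, this is the sum of the squares \<open>x g * x g\<close> of its integer coefficients, and
  \<open>x id\<close> does not vanish.
\<close>

lemma sum_symmetrizer_product_nonzero:
  assumes P: "young_set r c P"
  defines "\<chi> \<equiv> \<lambda>g. if g \<in> fiber_perms c P then sign g else 0"
  shows "(\<Sum>p\<in>fiber_perms r P. \<Sum>p'\<in>fiber_perms r P. \<Sum>q\<in>fiber_perms c P.
      sign q * \<chi> (p \<circ> q \<circ> p')) \<noteq> 0" (is "?Y \<noteq> 0")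
proof -
  let ?R = "fiber_perms r P" and ?C = "fiber_perms c P" and ?G = "{g. g permutes P}"
  have fP: "finite P" using P by (simp add: young_set_def)
  have fR: "finite ?R" and fC: "finite ?C" and fG: "finite ?G"
    using fP by (auto simp: finite_fiber_perms finite_permutations)
  have perm: "g permutes P" if "g \<in> ?R \<or> g \<in> ?C" for g
    using that by (auto simp: fiber_perms_def)
  have sgn2: "sign g * (sign g * z) = z" for g :: "'a \<Rightarrow> 'a" and z
    by (simp add: sign_def)
  have \<chi>_left: "\<chi> (k \<circ> g) = sign k * \<chi> g" if k: "k \<in> ?C" for k g
  proof (cases "g \<in> ?C")
    case True
    then show ?thesis
      using k by (simp add: \<chi>_def comp_in_fiber_perms sign_comp_permutes[OF fP perm perm])
  next
    case False
    have "k \<circ> g \<notin> ?C"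
      using comp_in_fiber_perms[OF inv_in_fiber_perms[OF k], of "k \<circ> g"] False
      by (auto simp: permutes_inv_cancel[OF perm] k)
    then show ?thesis using False by (simp add: \<chi>_def)
  qed
  \<comment> \<open>The square of the column antisymmetrizer is \<open>card ?C\<close> times itself;
    this is the coefficient at \<open>inv a \<circ> b\<close>.\<close>
  have \<chi>_pair: "(\<Sum>g\<in>?G. \<chi> (g \<circ> a) * \<chi> (g \<circ> b)) = int (card ?C) * \<chi> (inv a \<circ> b)"
    if a: "a permutes P" and b: "b permutes P" for a b
  proof -
    have "(\<Sum>g\<in>?G. \<chi> (g \<circ> a) * \<chi> (g \<circ> b)) = (\<Sum>g\<in>?G. \<chi> g * \<chi> (g \<circ> (inv a \<circ> b)))"
      by (rule sum.reindex_bij_witness[of _ "\<lambda>g. g \<circ> inv a" "\<lambda>g. g \<circ> a"])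
        (use a in \<open>auto simp: permutes_compose permutes_inv permutes_inv_cancel permutes_inv_o comp_assoc\<close>)
    also have "\<dots> = (\<Sum>g\<in>?C. \<chi> g * \<chi> (g \<circ> (inv a \<circ> b)))"
      by (rule sum.mono_neutral_right[OF fG]) (auto simp: \<chi>_def perm)
    also have "\<dots> = (\<Sum>g\<in>?C. \<chi> (inv a \<circ> b))"
      by (rule sum.cong[OF refl], subst \<chi>_left) (auto simp: \<chi>_def sgn2)
    finally show ?thesis by simp
  qed
  \<comment> \<open>A nonzero term is a factorization
    \<open>g = q' \<circ> inv p \<circ> inv q\<close> with \<open>q'\<close> in the column group, so
    \<open>x g\<close> is the coefficient of \<open>g\<close> in \<open>b a b\<close>.\<close>
  define x where "x g = (\<Sum>p\<in>?R. \<Sum>q\<in>?C. sign q * \<chi> (g \<circ> (q \<circ> p)))" for g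
  have inner: "(\<Sum>q\<in>?C. \<Sum>q'\<in>?C. sign q * sign q' * \<chi> (inv (q \<circ> p) \<circ> (q' \<circ> p'))) =
      int (card ?C) * (\<Sum>q\<in>?C. sign q * \<chi> (inv p \<circ> q \<circ> p'))" if p: "p \<in> ?R" for p p'
  proof -
    have "(\<Sum>q'\<in>?C. sign q * sign q' * \<chi> (inv (q \<circ> p) \<circ> (q' \<circ> p'))) =
        (\<Sum>q'\<in>?C. sign q' * \<chi> (inv p \<circ> q' \<circ> p'))" if q: "q \<in> ?C" for q
    proof -
      have inv: "inv (q \<circ> p) = inv p \<circ> inv q"
        by (rule o_inv_distrib) (use p q perm permutes_bij in blast)+
      have "(\<Sum>q'\<in>?C. sign q * sign q' * \<chi> (inv (q \<circ> p) \<circ> (q' \<circ> p'))) =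
         (\<Sum>q'\<in>?C. sign q * sign (q \<circ> q') * \<chi> (inv (q \<circ> p) \<circ> ((q \<circ> q') \<circ> p')))"
        by (rule sum_fiber_perms_left[OF q, symmetric])
      also have "\<dots> = (\<Sum>q'\<in>?C. sign q' * \<chi> (inv p \<circ> q' \<circ> p'))"
        by (rule sum.cong) (use q in \<open>simp_all add: inv comp_assoc permutes_inv_cancel[OF perm]
            sign_comp_permutes[OF fP perm perm] sgn2 mult.assoc\<close>)
      finally show ?thesis .
    qed
    then show ?thesis by simp
  qed
  have "(\<Sum>g\<in>?G. x g * x g) =
      (\<Sum>g\<in>?G. \<Sum>p\<in>?R. \<Sum>p'\<in>?R. \<Sum>q\<in>?C. \<Sum>q'\<in>?C.
        sign q * sign q' * (\<chi> (g \<circ> (q \<circ> p)) * \<chi> (g \<circ> (q' \<circ> p'))))"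
    unfolding x_def by (simp add: sum_product algebra_simps)
  also have "\<dots> = (\<Sum>p\<in>?R. \<Sum>p'\<in>?R. \<Sum>q\<in>?C. \<Sum>q'\<in>?C. sign q * sign q' *
        (\<Sum>g\<in>?G. \<chi> (g \<circ> (q \<circ> p)) * \<chi> (g \<circ> (q' \<circ> p'))))"
    by (simp only: sum.swap[of _ _ ?G] sum_distrib_left)
  also have "\<dots> = (\<Sum>p\<in>?R. \<Sum>p'\<in>?R. int (card ?C) *
      (\<Sum>q\<in>?C. \<Sum>q'\<in>?C. sign q * sign q' * \<chi> (inv (q \<circ> p) \<circ> (q' \<circ> p'))))"
    unfolding sum_distrib_left[of "int (card ?C)"]
    by (intro sum.cong refl, subst \<chi>_pair) (auto simp: perm permutes_compose mult_ac)
  also have "\<dots> = (\<Sum>p\<in>?R. \<Sum>p'\<in>?R. int (card ?C) * (int (card ?C) *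
      (\<Sum>q\<in>?C. sign q * \<chi> (inv p \<circ> q \<circ> p'))))"
    by (simp only: inner cong: sum.cong)
  also have "\<dots> = (\<Sum>p\<in>?R. \<Sum>p'\<in>?R. int (card ?C) * (int (card ?C) *
      (\<Sum>q\<in>?C. sign q * \<chi> (p \<circ> q \<circ> p'))))"
    by (rule sum_fiber_perms_inv)
  also have "\<dots> = int (card ?C) * (int (card ?C) * ?Y)"
    by (simp add: sum_distrib_left)
  finally have "(\<Sum>g\<in>?G. x g * x g) = int (card ?C) * (int (card ?C) * ?Y)" .
  moreover have "0 < (\<Sum>g\<in>?G. x g * x g)"
  proof (rule sum_pos2[OF fG, of id])
    \<comment> \<open>At the identity only \<open>p = id\<close> contributes, since a row
      permutation in the column group is trivial; thus \<open>x id = card ?C\<close>.\<close>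
    have "\<chi> p = (if p = id then 1 else 0)" if "p \<in> ?R" for p
      using row_col_perms_trivial[OF P that] id_in_fiber_perms[of c P] by (auto simp: \<chi>_def)
    then have "x id = (\<Sum>p\<in>?R. \<Sum>q\<in>?C. if p = id then 1 else 0)"
      unfolding x_def by (intro sum.cong refl) (simp add: \<chi>_left sgn2)
    also have "\<dots> = (\<Sum>p\<in>?R. if p = id then int (card ?C) else 0)"
      by (intro sum.cong) auto
    also have "\<dots> = int (card ?C)"
      using fR id_in_fiber_perms[of r P] by simp
    finally have "x id \<noteq> 0" using fC id_in_fiber_perms[of c P] by (auto simp: card_eq_0_iff)
    then show "0 < x id * x id" by (auto simp: zero_less_mult_iff)
  qed (auto simp: permutes_id)
  ultimately show ?thesis by auto
qed

text \<open>The column counts that a Young diagram can have. Columns are numbered from 1: with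
  column 0 empty, the inequality at \<open>j = 0\<close> would force column 1 to be empty.\<close>

definition antitone_cols :: "('a \<Rightarrow> nat) \<Rightarrow> 'a set \<Rightarrow> bool" where
  "antitone_cols c X \<longleftrightarrow> (\<forall>j\<ge>1. card {x\<in>X. c x = Suc j} \<le> card {x\<in>X. c x = j})"

context char_0_space
begin

text \<open>Each row permutation of \<open>P\<close> has its universal coefficient, and \<gamma> is
  their sum. The vector \<open>v0\<close> makes scalar test functions available in the value
  space.\<close>

lemma ysum_initial_symmetrizer:
  assumes P: "young_set r c P" and "v0 \<noteq> (0 :: 'v)"
  shows "\<exists>\<gamma>. \<gamma> \<noteq> 0 \<and> (\<forall>A \<Phi>. young_set r c A \<and> P \<subseteq> A \<longrightarrow>
    (\<Sum>p\<in>fiber_perms r P. alt_ysum r c A P \<Phi> p) - \<gamma> *s ysum r c A \<Phi> id \<in>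
      span (ysum r c A \<Phi> ` lowered c P (\<Sum>b\<in>P. c b) A))"
proof -
  let ?R = "fiber_perms r P" and ?C = "fiber_perms c P"
  have fP: "finite P" using P by (simp add: young_set_def)
  have "\<forall>p\<in>?R. \<exists>\<gamma>. \<forall>A \<Phi>. young_set r c A \<and> P \<subseteq> A \<longrightarrow>
    alt_ysum r c A P \<Phi> p - \<gamma> *s ysum r c A \<Phi> id \<in>
      span (ysum r c A \<Phi> ` lowered c P (\<Sum>b\<in>P. c b) A)"
    by (intro ballI alt_ysum_leading_coeff P) (rule fiber_perms_permutes)
  from bchoice[OF this] obtain g where g: "\<forall>p\<in>?R. \<forall>A \<Phi>. young_set r c A \<and> P \<subseteq> A \<longrightarrow>
    alt_ysum r c A P \<Phi> p - g p *s ysum r c A \<Phi> id \<in>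
      span (ysum r c A \<Phi> ` lowered c P (\<Sum>b\<in>P. c b) A)" by (rule exE)
  define \<gamma> where "\<gamma> = (\<Sum>p\<in>?R. g p)"
  have span: "(\<Sum>p\<in>?R. alt_ysum r c A P \<Phi> p) - \<gamma> *s ysum r c A \<Phi> id \<in>
      span (ysum r c A \<Phi> ` lowered c P (\<Sum>b\<in>P. c b) A)" if "young_set r c A" "P \<subseteq> A" for A \<Phi>
    unfolding \<gamma>_def scale_sum_left sum_subtractf[symmetric]
    using g that by (intro span_sum) blast
  have "\<gamma> \<noteq> 0"
  proof
    assume "\<gamma> = 0"
    define \<chi> where "\<chi> = (\<lambda>g. if g \<in> ?C then sign g else 0)"
    define Y where "Y = (\<Sum>p\<in>?R. \<Sum>p'\<in>?R. \<Sum>q\<in>?C. sign q * \<chi> (p \<circ> q \<circ> p'))"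
    have "Y \<noteq> 0" unfolding Y_def \<chi>_def by (rule sum_symmetrizer_product_nonzero[OF P])
    \<comment> \<open>Extended linearly, this test function sends the square of the Young
      symmetrizer of \<open>P\<close> to \<open>card ?C * Y\<close> times \<open>v0\<close>, which
      \<gamma> = 0 would force to vanish.\<close>
    define \<Phi> where "\<Phi> g = of_int (\<chi> g) *s v0" for g
    \<comment> \<open>The coefficient is universal, so it can be computed for \<open>A = P\<close>, where nothing can be lowered.\<close>
    have "lowered c P (\<Sum>b\<in>P. c b) P = {}"
      using sum_permutes[of _ P c] by (auto simp: lowered_def)
    with span[OF P subset_refl, of \<Phi>] \<open>\<gamma> = 0\<close> have zero: "(\<Sum>p\<in>?R. alt_ysum r c P P \<Phi> p) = 0"
      by simp
    have \<chi>_right: "\<chi> (g \<circ> h) = sign h * \<chi> g" if h: "h \<in> ?C" for g h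
    proof (cases "g \<in> ?C")
      case True
      then show ?thesis using h
        by (simp add: \<chi>_def comp_in_fiber_perms
            sign_comp_permutes[OF fP fiber_perms_permutes fiber_perms_permutes])
    next
      case False
      have "g \<circ> h \<notin> ?C"
        using comp_in_fiber_perms[OF _ inv_in_fiber_perms[OF h], of "g \<circ> h"] False
        by (auto simp: permutes_inv_cancel[OF fiber_perms_permutes[OF h]])
      then show ?thesis using False by (simp add: \<chi>_def)
    qed
    have "of_int (sign h) *s ysum r c P \<Phi> (p' \<circ> h) = ysum r c P \<Phi> p'" if h: "h \<in> ?C" for h p'
    proof -
      have e: "\<Phi> (p \<circ> q \<circ> (p' \<circ> h)) = of_int (sign h) *s \<Phi> (p \<circ> q \<circ> p')" for p q
        using \<chi>_right[OF h, of "p \<circ> q \<circ> p'"] by (simp add: \<Phi>_def comp_assoc)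
      then have "of_int (sign h) *s of_int (sign q) *s \<Phi> (p \<circ> q \<circ> (p' \<circ> h)) =
          of_int (sign q) *s \<Phi> (p \<circ> q \<circ> p')" for p q
        by (simp add: e mult.left_commute[of "of_int (sign h)"] of_int_sign_square)
      then show ?thesis by (simp only: ysum_def scale_sum_right)
    qed
    then have "alt_ysum r c P P \<Phi> p' = of_nat (card ?C) *s ysum r c P \<Phi> p'" for p'
      unfolding alt_ysum_def by (simp add: sum_constant_scale)
    then have "of_nat (card ?C) *s (\<Sum>p'\<in>?R. ysum r c P \<Phi> p') = 0"
      using zero by (simp add: scale_sum_right)
    moreover have "card ?C \<noteq> 0"
      using finite_fiber_perms[OF fP, of c] id_in_fiber_perms[of c P] by (auto simp: card_eq_0_iff)
    moreover have "(\<Sum>p'\<in>?R. ysum r c P \<Phi> p') = of_int Y *s v0"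
      unfolding ysum_def Y_def \<Phi>_def
      by (subst sum.swap) (simp add: scale_sum_left)
    ultimately show False using \<open>Y \<noteq> 0\<close> \<open>v0 \<noteq> 0\<close> by simp
  qed
  then show ?thesis using span by blast
qed

text \<open>The inequalities won by the first straightening must survive, so no relation may move a
  label of \<open>P\<close> to the right. The induction runs on the column sum of \<open>P\<close>,
  which drops in every new term.\<close>

lemma ysum_antitone_cols:
  assumes A: "young_set r c A" and "P \<subseteq> A" and "\<sigma> permutes A"
  shows "ysum r c A \<Phi> \<sigma> \<in> span (ysum r c A \<Phi> `
    {\<tau>. \<tau> permutes A \<and> (\<forall>b\<in>P. c (\<tau> b) \<le> c (\<sigma> b)) \<and> antitone_cols c (\<tau> ` P)})"
  using assms(3)
proof (induction "\<Sum>b\<in>P. c (\<sigma> b)" arbitrary: \<sigma> rule: less_induct)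
  case less
  note \<sigma> = less.prems
  let ?T = "\<lambda>\<sigma>. ysum r c A \<Phi> `
    {\<tau>. \<tau> permutes A \<and> (\<forall>b\<in>P. c (\<tau> b) \<le> c (\<sigma> b)) \<and> antitone_cols c (\<tau> ` P)}"
  have fA: "finite A" and fP: "finite P"
    using A \<open>P \<subseteq> A\<close> by (auto simp: young_set_def finite_subset)
  show ?case
  proof (cases "antitone_cols c (\<sigma> ` P)")
    case True
    then show ?thesis using \<sigma> by (intro span_base) auto
  next
    case False
    then obtain j where j: "1 \<le> j"
      "card {x\<in>\<sigma> ` P. c x = j} < card {x\<in>\<sigma> ` P. c x = Suc j}"
      unfolding antitone_cols_def by (meson not_le)
    \<comment> \<open>A Garnir relation on the labels of \<open>P\<close> in column \<open>j + 1\<close> and the other labels in column \<open>j\<close>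
        moves labels of \<open>P\<close> only to the left.\<close>
    define X where "X = {x\<in>\<sigma> ` P. c x = Suc j}"
    define W where "W = {x\<in>A - \<sigma> ` P. c x = j}"
    define Z where "Z = X \<union> W"
    have \<sigma>P: "\<sigma> ` P \<subseteq> A" using \<open>P \<subseteq> A\<close> permutes_image[OF \<sigma>] by blast
    have XW: "X \<inter> W = {}" "finite X" "finite W" "X \<subseteq> A" "W \<subseteq> A"
      using \<sigma>P fA fP by (auto simp: X_def W_def)
    then have fZ: "finite Z" and ZA: "Z \<subseteq> A" by (auto simp: Z_def)
    have "{x\<in>A. c x = j} = {x\<in>\<sigma> ` P. c x = j} \<union> W"
      using \<sigma>P by (auto simp: W_def)
    also have "card \<dots> = card {x\<in>\<sigma> ` P. c x = j} + card W"
      using fP XW by (intro card_Un_disjoint) (auto simp: W_def)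
    also have "\<dots> < card Z"
      unfolding Z_def using j(2) XW by (simp add: card_Un_disjoint X_def)
    finally have card: "card {x\<in>A. c x = j} < card Z" .
    let ?G = "{g. g permutes Z}" and ?H = "{g. g permutes Z \<and> g ` X \<subseteq> X}"
    have fG: "finite ?G" using fZ by (rule finite_permutations)
    have sum0: "(\<Sum>g\<in>?G. of_int (sign g) *s ysum r c A \<Phi> (g \<circ> \<sigma>)) = 0"
      by (rule garnir[OF A ZA j(1) lessI _ card]) (auto simp: Z_def X_def W_def)
    \<comment> \<open>A permutation of \<open>Z\<close> preserving \<open>X\<close> also preserves
      \<open>W\<close>, so it is a column permutation and its term repeats that of \<sigma>. Every
      other one brings a label of \<open>P\<close> from column \<open>j + 1\<close> to column
      \<open>j\<close>.\<close>
    have H: "of_int (sign g) *s ysum r c A \<Phi> (g \<circ> \<sigma>) = ysum r c A \<Phi> \<sigma>" if g: "g \<in> ?H" for g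
    proof -
      have gZ: "g permutes Z" and gX: "g ` X \<subseteq> X" using g by auto
      have inj: "inj g" using permutes_inj[OF gZ] .
      have "g ` X = X" using gX XW(2) inj by (meson card_image card_subset_eq inj_on_subset subset_UNIV)
      moreover have "g ` Z = Z" by (rule permutes_image[OF gZ])
      moreover have "W = Z - X" using XW(1) by (auto simp: Z_def)
      ultimately have gW: "g ` W = W" by (simp add: image_set_diff[OF inj])
      have "g \<in> fiber_perms c A"
      proof (rule fiber_permsI[OF gZ ZA])
        fix z assume "z \<in> Z"
        then consider "z \<in> X" "g z \<in> X" | "z \<in> W" "g z \<in> W"
          using gX gW by (auto simp: Z_def)
        then show "c (g z) = c z" by cases (auto simp: X_def W_def)
      qed
      then show ?thesis by (simp add: ysum_col_left[OF fA] of_int_sign_square)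
    qed
    have rest: "ysum r c A \<Phi> (g \<circ> \<sigma>) \<in> span (?T \<sigma>)" if g: "g \<in> ?G - ?H" for g
    proof -
      have gZ: "g permutes Z" using g by simp
      have perm: "g \<circ> \<sigma> permutes A" by (rule permutes_compose[OF \<sigma> permutes_subset[OF gZ ZA]])
      have le: "c (g (\<sigma> b)) \<le> c (\<sigma> b)" if b: "b \<in> P" for b
      proof (cases "\<sigma> b \<in> X")
        case True
        then have "g (\<sigma> b) \<in> Z" using permutes_in_image[OF gZ] by (auto simp: Z_def)
        then show ?thesis using True by (auto simp: Z_def X_def W_def)
      next
        case False
        then have "\<sigma> b \<notin> Z" using b by (auto simp: Z_def W_def)
        then show ?thesis by (simp add: permutes_not_in[OF gZ])
      qed
      obtain x where x: "x \<in> X" "g x \<notin> X" using g by auto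
      then have "g x \<in> W" using permutes_in_image[OF gZ, of x] by (auto simp: Z_def)
      with x obtain b where "b \<in> P" "c (g (\<sigma> b)) < c (\<sigma> b)"
        by (auto simp: X_def W_def)
      then have less': "(\<Sum>b\<in>P. c ((g \<circ> \<sigma>) b)) < (\<Sum>b\<in>P. c (\<sigma> b))"
        using le fP by (intro sum_strict_mono_ex1) auto
      have "?T (g \<circ> \<sigma>) \<subseteq> ?T \<sigma>"
        by (rule image_mono) (auto intro: order_trans[OF _ le])
      with less.hyps[OF less' perm] show ?thesis using span_mono by blast
    qed
    have "(\<Sum>g\<in>?G. of_int (sign g) *s ysum r c A \<Phi> (g \<circ> \<sigma>)) =
        (\<Sum>g\<in>?G - ?H. of_int (sign g) *s ysum r c A \<Phi> (g \<circ> \<sigma>)) +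
        (\<Sum>g\<in>?H. of_int (sign g) *s ysum r c A \<Phi> (g \<circ> \<sigma>))"
      by (rule sum.subset_diff[OF _ fG]) auto
    also have "(\<Sum>g\<in>?H. of_int (sign g) *s ysum r c A \<Phi> (g \<circ> \<sigma>)) = of_nat (card ?H) *s ysum r c A \<Phi> \<sigma>"
      by (simp only: H sum_constant_scale cong: sum.cong)
    finally have "of_nat (card ?H) *s ysum r c A \<Phi> \<sigma> =
        - (\<Sum>g\<in>?G - ?H. of_int (sign g) *s ysum r c A \<Phi> (g \<circ> \<sigma>))"
      using sum0 by (simp add: eq_neg_iff_add_eq_0 add.commute comp_def)
    also have "\<dots> \<in> span (?T \<sigma>)"
      by (intro span_neg span_sum span_scale rest)
    finally show ?thesis
    proof (rule span_scale_cancel)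
      have "finite ?H" using fG by (rule rev_finite_subset) auto
      moreover have "id \<in> ?H" by (simp add: permutes_id)
      ultimately have "card ?H \<noteq> 0" by (metis card_0_eq empty_iff)
      then show "of_nat (card ?H) \<noteq> (0 :: 'k)" by simp
    qed
  qed
qed

text \<open>The relation for \<open>c(T) c(S)\<close> is solved for \<open>c(T)\<close>, so \<beta>
  is the inverse of \<gamma>. The strict bound on the column sum gives one strict inequality, which
  persists because the second straightening moves labels of \<open>P\<close> only to the
  left.\<close>

lemma ysum_straighten:
  assumes A: "young_set r c A" and P: "young_set r c P" "P \<subseteq> A" and "v0 \<noteq> (0 :: 'v)"
  shows "\<exists>\<beta>. ysum r c A \<Phi> id - \<beta> *s (\<Sum>p\<in>fiber_perms r P. alt_ysum r c A P \<Phi> p) \<in>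
    span (ysum r c A \<Phi> ` {\<tau>. \<tau> permutes A \<and> (\<forall>b\<in>P. c (\<tau> b) \<le> c b) \<and>
      (\<exists>b\<in>P. c (\<tau> b) < c b) \<and> antitone_cols c (\<tau> ` P)})" (is "\<exists>\<beta>. _ \<in> span ?S")
proof -
  let ?B = "\<Sum>p\<in>fiber_perms r P. alt_ysum r c A P \<Phi> p"
  obtain \<gamma> where \<gamma>: "\<gamma> \<noteq> 0" and
    in_span: "?B - \<gamma> *s ysum r c A \<Phi> id \<in> span (ysum r c A \<Phi> ` lowered c P (\<Sum>b\<in>P. c b) A)"
    using ysum_initial_symmetrizer[OF P(1) assms(4)] A P(2) by blast
  have "ysum r c A \<Phi> ` lowered c P (\<Sum>b\<in>P. c b) A \<subseteq> span ?S"
  proof safe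
    fix \<sigma> assume \<sigma>: "\<sigma> \<in> lowered c P (\<Sum>b\<in>P. c b) A"
    then have perm: "\<sigma> permutes A" and le: "\<And>b. b \<in> P \<Longrightarrow> c (\<sigma> b) \<le> c b"
      and "(\<Sum>b\<in>P. c (\<sigma> b)) < (\<Sum>b\<in>P. c b)" by (auto simp: lowered_def)
    then obtain b where b: "b \<in> P" "c (\<sigma> b) < c b" by (meson not_le sum_mono)
    have "{\<tau>. \<tau> permutes A \<and> (\<forall>b\<in>P. c (\<tau> b) \<le> c (\<sigma> b)) \<and> antitone_cols c (\<tau> ` P)} \<subseteq>
      {\<tau>. \<tau> permutes A \<and> (\<forall>b\<in>P. c (\<tau> b) \<le> c b) \<and> (\<exists>b\<in>P. c (\<tau> b) < c b) \<and> antitone_cols c (\<tau> ` P)}"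
      using b by (auto intro: order_trans[OF _ le] intro!: bexI[of _ b] elim!: le_less_trans[rotated])
    from ysum_antitone_cols[OF A P(2) perm, of \<Phi>] span_mono[OF image_mono[OF this]]
    show "ysum r c A \<Phi> \<sigma> \<in> span ?S" by blast
  qed
  then have "span (ysum r c A \<Phi> ` lowered c P (\<Sum>b\<in>P. c b) A) \<subseteq> span ?S"
    by (rule span_minimal[OF _ subspace_span])
  with in_span have "?B - \<gamma> *s ysum r c A \<Phi> id \<in> span ?S" by blast
  then have "(- inverse \<gamma>) *s (?B - \<gamma> *s ysum r c A \<Phi> id) \<in> span ?S" by (rule span_scale)
  then have "ysum r c A \<Phi> id - inverse \<gamma> *s ?B \<in> span ?S"
    using \<gamma> by (simp add: scale_right_diff_distrib)
  then show ?thesis by blast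
qed

end

section \<open>The action of the group algebra on polynomials\<close>

lemma zact_superset:
  assumes "finite K" "Poly_Mapping.keys p \<subseteq> K"
  shows "zact \<phi> p =
    (\<Sum>m\<in>K. Poly_Mapping.single (image_mset (image \<phi>) m) (Poly_Mapping.lookup p m))"
  unfolding zact_def
  by (rule sum.mono_neutral_left[OF assms]) (auto simp: in_keys_iff)

lemma zact_add: "zact \<phi> (p + q) = zact \<phi> p + zact \<phi> q"
  using Poly_Mapping.keys_add[of p q]
  by (subst (1 2 3) zact_superset[of "Poly_Mapping.keys p \<union> Poly_Mapping.keys q"])
    (auto simp: lookup_add single_add sum.distrib)

lemma zact_zero [simp]: "zact \<phi> 0 = 0"
  by (simp add: zact_def)

lemma zact_sum: "zact \<phi> (\<Sum>i\<in>I. f i) = (\<Sum>i\<in>I. zact \<phi> (f i))"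
  by (induction I rule: infinite_finite_induct) (simp_all add: zact_add)

lemma zact_single:
  "zact \<phi> (Poly_Mapping.single m c) = Poly_Mapping.single (image_mset (image \<phi>) m) c"
  by (subst zact_superset[of "{m}"]) auto

lemma zscale_single: "zscale c (Poly_Mapping.single m b) = Poly_Mapping.single m (c * b)"
  by (simp add: zscale_def mult_single)

lemma zscale_mult_left: "zscale c (p * q) = zscale c p * q"
  by (simp add: zscale_def mult.assoc)

lemma zscale_sum: "zscale c (\<Sum>i\<in>I. f i) = (\<Sum>i\<in>I. zscale c (f i))"
  by (rule zp.scale_sum_right)

lemma zscale_zscale: "zscale a (zscale b p) = zscale (a * b) p"
  by (rule zp.scale_scale)

lemma sum_single_keys:
  "(\<Sum>m\<in>Poly_Mapping.keys p. Poly_Mapping.single m (Poly_Mapping.lookup p m)) = p"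
  by (rule poly_mapping_eqI) (simp add: lookup_sum lookup_single when_def in_keys_iff)

lemma zact_scale: "zact \<phi> (zscale c p) = zscale c (zact \<phi> p)"
proof -
  have "zact \<phi> (zscale c p) =
      zact \<phi> (zscale c (\<Sum>m\<in>Poly_Mapping.keys p. Poly_Mapping.single m (Poly_Mapping.lookup p m)))"
    by (simp only: sum_single_keys)
  also have "\<dots> = zscale c (zact \<phi> p)"
    by (simp add: zscale_sum zact_sum zscale_single zact_single) (simp add: zact_def zscale_sum zscale_single)
  finally show ?thesis .
qed

lemma zact_comp: "zact (\<sigma> \<circ> \<tau>) p = zact \<sigma> (zact \<tau> p)"
proof -
  have "image_mset (image (\<sigma> \<circ> \<tau>)) m = image_mset (image \<sigma>) (image_mset (image \<tau>) m)" for m :: "'a set multiset"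
    by (simp add: multiset.map_comp comp_def image_image)
  then show ?thesis by (simp add: zact_def[of _ p] zact_sum zact_single)
qed

lemma zact_id [simp]: "zact id p = p"
  by (simp add: zact_def sum_single_keys)

lemma prod_zvar: "(\<Prod>i\<in>I. zvar (X i)) = Poly_Mapping.single (\<Sum>i\<in>I. {#X i#}) (1 :: 'k::field)"
  by (induction I rule: infinite_finite_induct) (simp_all add: zvar_def mult_single flip: single_one)

lemma zact_prod_zvar:
  "zact \<phi> (\<Prod>i\<in>I. zvar (X i) :: ('a, 'k::field) zpoly) = (\<Prod>i\<in>I. zvar (\<phi> ` X i))"
proof -
  have "image_mset (image \<phi>) (\<Sum>i\<in>I. {#X i#}) = (\<Sum>i\<in>I. {#\<phi> ` X i#})"
    by (induction I rule: infinite_finite_induct) simp_all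
  then show ?thesis by (simp add: prod_zvar zact_single)
qed

lemma ga_act_superset:
  assumes "finite K" "Poly_Mapping.keys f \<subseteq> K"
  shows "ga_act f p = (\<Sum>\<sigma>\<in>K. zscale (Poly_Mapping.lookup f \<sigma>) (zact \<sigma> p))"
  unfolding ga_act_def
  by (rule sum.mono_neutral_left[OF assms]) (auto simp: in_keys_iff zp.scale_zero_left)

lemma ga_act_add: "ga_act (f + g) p = ga_act f p + ga_act g p"
  using Poly_Mapping.keys_add[of f g]
  by (subst (1 2 3) ga_act_superset[of "Poly_Mapping.keys f \<union> Poly_Mapping.keys g"])
    (auto simp: lookup_add zp.scale_left_distrib sum.distrib)

lemma ga_act_zero [simp]: "ga_act 0 p = 0"
  by (simp add: ga_act_def)

lemma ga_act_sum: "ga_act (\<Sum>i\<in>I. f i) p = (\<Sum>i\<in>I. ga_act (f i) p)"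
  by (induction I rule: infinite_finite_induct) (simp_all add: ga_act_add)

lemma ga_act_single: "ga_act (Poly_Mapping.single \<sigma> c) p = zscale c (zact \<sigma> p)"
  by (subst ga_act_superset[of "{\<sigma>}"]) auto

lemma ga_act_mult: "ga_act (ga_mult f g) p = ga_act f (ga_act g p)"
  by (simp add: ga_mult_def ga_act_sum ga_act_single)
    (simp add: ga_act_def zact_sum zact_scale zact_comp zscale_sum zscale_zscale)

lemma ga_act_prod: "ga_act (ga_prod fs) p = foldr ga_act fs p"
proof (induction fs)
  case Nil
  show ?case
    by (simp add: ga_prod_def ga_one_def ga_act_single zp.scale_one)
next
  case (Cons f fs)
  then show ?case by (simp add: ga_prod_def ga_act_mult)
qed

text \<open>Within \<open>X \<union> Y\<close> the set \<open>X\<close> is the whole fiber over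
  \<open>j\<close>, so it is mapped to itself and each permutation splits uniquely into one of
  \<open>X\<close> and one of \<open>Y\<close>.\<close>

lemma sum_fiber_perms_Un:
  assumes "finite X" "finite Y" and f: "\<And>x. x \<in> X \<Longrightarrow> f x = j" "\<And>y. y \<in> Y \<Longrightarrow> f y \<noteq> j"
  shows "(\<Sum>\<rho>\<in>fiber_perms f (X \<union> Y). h \<rho>) =
    (\<Sum>\<sigma> | \<sigma> permutes X. \<Sum>\<tau>\<in>fiber_perms f Y. h (\<sigma> \<circ> \<tau>))"
proof -
  have disj: "X \<inter> Y = {}" using f by auto
  let ?S = "{\<sigma>. \<sigma> permutes X} \<times> fiber_perms f Y"
  have comp: "\<sigma> \<circ> \<tau> \<in> fiber_perms f (X \<union> Y)"
    if "\<sigma> permutes X" "\<tau> \<in> fiber_perms f Y" for \<sigma> \<tau>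
  proof (rule comp_in_fiber_perms)
    show "\<sigma> \<in> fiber_perms f (X \<union> Y)"
      using that(1) f(1) by (intro fiber_permsI[OF that(1)]) (auto simp: permutes_in_image)
    show "\<tau> \<in> fiber_perms f (X \<union> Y)"
      using that(2) fiber_perms_mono[of Y "X \<union> Y" f] by auto
  qed
  define res where "res \<rho> = (\<lambda>x. if x \<in> X then \<rho> x else x)" for \<rho> :: "'a \<Rightarrow> 'a"
  have res: "res \<rho> permutes X" "inv (res \<rho>) \<circ> \<rho> \<in> fiber_perms f Y" if \<rho>: "\<rho> \<in> fiber_perms f (X \<union> Y)" for \<rho>
  proof -
    have perm: "\<rho> permutes X \<union> Y" and f\<rho>: "f (\<rho> x) = f x" for x
      using \<rho> by (auto simp: fiber_perms_def)
    have sub: "\<rho> ` X \<subseteq> X"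
    proof
      fix y assume "y \<in> \<rho> ` X"
      then have "y \<in> X \<union> Y" "f y = j"
        using permutes_in_image[OF perm] f\<rho> f(1) by auto
      then show "y \<in> X" using f(2) by auto
    qed
    have inj: "inj_on \<rho> X" using permutes_inj[OF perm] by (auto intro: inj_on_subset)
    have "bij_betw \<rho> X X"
      unfolding bij_betw_def using inj endo_inj_surj[OF assms(1) sub inj] by simp
    then have "bij_betw (res \<rho>) X X"
      by (rule bij_betw_cong[THEN iffD1, rotated]) (simp add: res_def)
    then show rp: "res \<rho> permutes X"
      by (rule bij_imp_permutes) (simp add: res_def)
    have "inv (res \<rho>) \<circ> \<rho> permutes X \<union> Y"
      by (intro permutes_compose perm permutes_subset[OF permutes_inv[OF rp]]) auto
    moreover have "(inv (res \<rho>) \<circ> \<rho>) x = x" if "x \<in> X" for x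
    proof -
      have "\<rho> x = res \<rho> x" using that by (simp add: res_def)
      then show ?thesis by (simp add: permutes_inverses[OF rp])
    qed
    ultimately have py: "inv (res \<rho>) \<circ> \<rho> permutes Y"
      by (auto intro: permutes_superset)
    have "inv (res \<rho>) \<in> fiber_perms f (X \<union> Y)"
      using permutes_inv[OF rp] f(1)
      by (intro fiber_permsI[OF permutes_inv[OF rp]]) (auto simp: permutes_in_image)
    then have "f ((inv (res \<rho>) \<circ> \<rho>) x) = f x" for x
      using f\<rho> by (simp add: fiber_perms_def)
    with py show "inv (res \<rho>) \<circ> \<rho> \<in> fiber_perms f Y" by (simp add: fiber_perms_def)
  qed
  have "(\<Sum>\<rho>\<in>fiber_perms f (X \<union> Y). h \<rho>) = (\<Sum>(\<sigma>, \<tau>)\<in>?S. h (\<sigma> \<circ> \<tau>))"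
  proof (rule sum.reindex_bij_witness[of _ "\<lambda>(\<sigma>, \<tau>). \<sigma> \<circ> \<tau>" "\<lambda>\<rho>. (res \<rho>, inv (res \<rho>) \<circ> \<rho>)"], goal_cases)
    case (1 \<rho>)
    then show ?case by (simp add: permutes_inv_cancel(1)[OF res(1)])
  next
    case (2 \<rho>)
    then show ?case using res by auto
  next
    case (3 s)
    then obtain \<sigma> \<tau> where s: "s = (\<sigma>, \<tau>)" "\<sigma> permutes X" "\<tau> permutes Y"
      by (auto simp: fiber_perms_def)
    have "\<tau> x = x" if "x \<in> X" for x
      using that disj by (intro permutes_not_in[OF s(3)]) auto
    then have "res (\<sigma> \<circ> \<tau>) = \<sigma>"
      using permutes_not_in[OF s(2)] by (auto simp: res_def fun_eq_iff)
    then show ?case using s by (simp add: permutes_inv_cancel)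
  next
    case (4 s)
    then show ?case using comp by auto
  next
    case (5 \<rho>)
    then show ?case by (simp add: permutes_inv_cancel(1)[OF res(1)])
  qed
  then show ?thesis by (simp add: sum.cartesian_product)
qed

text \<open>With \<open>w\<close> the trivial character these are row symmetrizers, with the sign
  column antisymmetrizers. Multiplicativity of \<open>w\<close> merges the factors of the single
  rows or columns into one sum over the row or column group.\<close>

lemma foldr_ga_act_fibers:
  fixes w :: "('a \<Rightarrow> 'a) \<Rightarrow> 'k::field"
  assumes "finite A" and "distinct js"
    and w: "w id = 1" "\<And>\<sigma> \<tau>. \<sigma> permutes A \<Longrightarrow> \<tau> permutes A \<Longrightarrow> w (\<sigma> \<circ> \<tau>) = w \<sigma> * w \<tau>"
  shows "foldr ga_act
      (map (\<lambda>j. \<Sum>\<sigma> | \<sigma> permutes {x\<in>A. f x = j}. Poly_Mapping.single \<sigma> (w \<sigma>)) js) p =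
    (\<Sum>\<sigma>\<in>fiber_perms f {x\<in>A. f x \<in> set js}. zscale (w \<sigma>) (zact \<sigma> p))"
  using assms(2)
proof (induction js)
  case Nil
  have "fiber_perms f {} = {id}" by (auto simp: fiber_perms_def)
  then show ?case
    by (simp add: w(1)[unfolded id_def] zact_id[unfolded id_def])
next
  case (Cons j js)
  let ?X = "{x\<in>A. f x = j}" and ?Y = "{x\<in>A. f x \<in> set js}"
  have XY: "{x\<in>A. f x \<in> set (j # js)} = ?X \<union> ?Y" by auto
  have "(\<Sum>\<rho>\<in>fiber_perms f (?X \<union> ?Y). zscale (w \<rho>) (zact \<rho> p)) =
     (\<Sum>\<sigma> | \<sigma> permutes ?X. \<Sum>\<tau>\<in>fiber_perms f ?Y. zscale (w (\<sigma> \<circ> \<tau>)) (zact (\<sigma> \<circ> \<tau>) p))"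
    by (rule sum_fiber_perms_Un[where j = j]) (use assms(1) Cons.prems in auto)
  also have "\<dots> = (\<Sum>\<sigma> | \<sigma> permutes ?X. zscale (w \<sigma>) (zact \<sigma>
      (\<Sum>\<tau>\<in>fiber_perms f ?Y. zscale (w \<tau>) (zact \<tau> p))))"
    unfolding zact_sum zscale_sum
  proof (intro sum.cong refl)
    fix \<sigma> \<tau> assume "\<sigma> \<in> {\<sigma>. \<sigma> permutes ?X}" "\<tau> \<in> fiber_perms f ?Y"
    then have "\<sigma> permutes A" "\<tau> permutes A"
      by (auto simp: fiber_perms_def intro: permutes_subset)
    then show "zscale (w (\<sigma> \<circ> \<tau>)) (zact (\<sigma> \<circ> \<tau>) p) = zscale (w \<sigma>) (zact \<sigma> (zscale (w \<tau>) (zact \<tau> p)))"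
      by (simp add: w(2) zact_scale zact_comp zscale_zscale)
  qed
  finally have "(\<Sum>\<rho>\<in>fiber_perms f (?X \<union> ?Y). zscale (w \<rho>) (zact \<rho> p)) = \<dots>" .
  then show ?case
    unfolding XY using Cons by (simp add: ga_act_sum ga_act_single)
qed

section \<open>Young symmetrizers of tableaux\<close>

lemma part_antimono: "is_partition l \<Longrightarrow> 1 \<le> i \<Longrightarrow> i \<le> i' \<Longrightarrow> part l i' \<le> part l i"
  by (cases "i = i'") (auto simp: part_def is_partition_def sorted_wrt_iff_nth_less)

lemma mem_diagram: "(i, j) \<in> diagram l \<longleftrightarrow> 1 \<le> i \<and> 1 \<le> j \<and> j \<le> part l i"
  by (simp add: diagram_def)

lemma finite_diagram: "finite (diagram l)"
proof (rule finite_subset)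
  show "diagram l \<subseteq> (SIGMA i:{1..length l}. {1..part l i})"
    by (auto simp: diagram_def part_def split: if_splits)
qed auto

lemma finite_fiber: "finite (fiber l F i)"
  by (rule finite_subset[OF _ finite_diagram[of l]]) (auto simp: fiber_def)

definition row_of :: "nat list \<Rightarrow> (box \<Rightarrow> 'a) \<Rightarrow> 'a \<Rightarrow> nat" where
  "row_of l T x = fst (inv_into (diagram l) T x)"

definition col_of :: "nat list \<Rightarrow> (box \<Rightarrow> 'a) \<Rightarrow> 'a \<Rightarrow> nat" where
  "col_of l T x = snd (inv_into (diagram l) T x)"

lemma row_col_of_apply:
  assumes "bij_betw T (diagram l) A" "b \<in> diagram l"
  shows "row_of l T (T b) = fst b" "col_of l T (T b) = snd b"
  using assms by (simp_all add: row_of_def col_of_def bij_betw_inv_into_left)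

lemma young_set_tableau:
  assumes T: "bij_betw T (diagram l) A"
  shows "young_set (row_of l T) (col_of l T) A"
  unfolding young_set_def
proof (intro conjI ballI allI impI)
  have A: "A = T ` diagram l" using T by (simp add: bij_betw_def)
  show "finite A" by (simp add: A finite_diagram)
  show "inj_on (\<lambda>x. (row_of l T x, col_of l T x)) A"
    by (rule inj_onI) (auto simp: A row_col_of_apply[OF T])
  fix x assume "x \<in> A"
  then obtain i j where x: "x = T (i, j)" "(i, j) \<in> diagram l" by (auto simp: A)
  then show "1 \<le> col_of l T x" by (simp add: row_col_of_apply[OF T] mem_diagram)
  fix j' assume "1 \<le> j' \<and> j' < col_of l T x"
  then have "(i, j') \<in> diagram l" using x by (simp add: row_col_of_apply[OF T] mem_diagram)
  then show "\<exists>y\<in>A. row_of l T y = row_of l T x \<and> col_of l T y = j'"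
    using x by (intro bexI[of _ "T (i, j')"]) (auto simp: A row_col_of_apply[OF T])
qed

interpretation zp0: char_0_space "zscale :: 'k::field_char_0 \<Rightarrow> ('a, 'k) zpoly \<Rightarrow> ('a, 'k) zpoly"
  by unfold_locales

lemma ga_act_young_symmetrizer:
  fixes p :: "('a, 'k::field_char_0) zpoly"
  assumes l: "is_partition l" and T: "bij_betw T (diagram l) A"
  shows "ga_act (young_symmetrizer l T) p =
    zp0.ysum (row_of l T) (col_of l T) A (\<lambda>\<sigma>. zact \<sigma> p) id"
proof -
  have A: "A = T ` diagram l" using T by (simp add: bij_betw_def)
  have fA: "finite A" by (simp add: A finite_diagram)
  have rows: "T ` {b \<in> diagram l. fst b = i} = {x\<in>A. row_of l T x = i}" for i
    by (auto simp: A row_col_of_apply[OF T])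
  have cols: "T ` {b \<in> diagram l. snd b = j} = {x\<in>A. col_of l T x = j}" for j
    by (auto simp: A row_col_of_apply[OF T])
  have "row_of l T x \<in> set [1..<Suc (length l)]" if x: "x \<in> A" for x
  proof -
    obtain i j where "x = T (i, j)" "(i, j) \<in> diagram l" using x by (auto simp: A)
    then show ?thesis
      by (auto simp: row_col_of_apply[OF T] mem_diagram part_def split: if_splits)
  qed
  then have all_rows: "{x\<in>A. row_of l T x \<in> set [1..<Suc (length l)]} = A" by auto
  \<comment> \<open>The antisymmetrizers run up to \<open>part l 1\<close>, which reaches every
    column because the first row is the longest.\<close>
  have "col_of l T x \<in> set [1..<Suc (part l 1)]" if x: "x \<in> A" for x
  proof -
    obtain i j where ij: "x = T (i, j)" "(i, j) \<in> diagram l" using x by (auto simp: A)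
    then have "part l i \<le> part l 1"
      by (intro part_antimono[OF l]) (auto simp: mem_diagram)
    moreover have "col_of l T x = j" "1 \<le> j" "j \<le> part l i"
      using ij by (simp_all add: row_col_of_apply[OF T] mem_diagram)
    ultimately have "1 \<le> col_of l T x \<and> col_of l T x \<le> part l 1" by linarith
    then show ?thesis by (simp only: set_upt atLeastLessThan_iff less_Suc_eq_le)
  qed
  then have all_cols: "{x\<in>A. col_of l T x \<in> set [1..<Suc (part l 1)]} = A" by auto
  have row: "foldr ga_act (map (\<lambda>i. row_sym {x\<in>A. row_of l T x = i}) [1..<Suc (length l)]) q =
      (\<Sum>\<sigma>\<in>fiber_perms (row_of l T) A. zact \<sigma> q)" for q :: "('a, 'k) zpoly"
    using foldr_ga_act_fibers[OF fA distinct_upt, of "\<lambda>_. 1" "row_of l T" 1 "Suc (length l)" q]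
    unfolding all_rows row_sym_def by simp
  have "of_int (sign (\<sigma> \<circ> \<tau>)) = of_int (sign \<sigma>) * (of_int (sign \<tau>) :: 'k)"
    if "\<sigma> permutes A" "\<tau> permutes A" for \<sigma> \<tau>
    using sign_comp_permutes[OF fA that] by simp
  then have col: "foldr ga_act (map (\<lambda>j. col_sym {x\<in>A. col_of l T x = j}) [1..<Suc (part l 1)]) q =
      (\<Sum>\<sigma>\<in>fiber_perms (col_of l T) A. zscale (of_int (sign \<sigma>)) (zact \<sigma> q))" for q :: "('a, 'k) zpoly"
    using foldr_ga_act_fibers[OF fA distinct_upt, of "\<lambda>\<sigma>. of_int (sign \<sigma>)" "col_of l T" 1 "Suc (part l 1)" q]
    unfolding all_cols col_sym_def by simp
  show ?thesis
    unfolding young_symmetrizer_def ga_act_mult ga_act_prod rows cols row col zp0.ysum_def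
    by (simp add: zact_sum zact_scale zact_comp)
qed

text \<open>The index set is a parameter so that the blocks with index at most \<open>k\<close> can
  be split off.\<close>

definition tableau_monomial ::
    "nat set \<Rightarrow> nat list \<Rightarrow> (box \<Rightarrow> nat) \<Rightarrow> (box \<Rightarrow> 'a) \<Rightarrow> ('a, 'k::field) zpoly" where
  "tableau_monomial I l F T = (\<Prod>i\<in>I. zvar (T ` fiber l F i))"

lemma t_elem_ysum:
  fixes T :: "box \<Rightarrow> 'a"
  assumes "is_partition l" "bij_betw T (diagram l) A"
  shows "(t_elem n l F T :: ('a, 'k::field_char_0) zpoly) =
    zp0.ysum (row_of l T) (col_of l T) A (\<lambda>\<sigma>. zact \<sigma> (tableau_monomial {1..n} l F T)) id"
  unfolding t_elem_def tableau_monomial_def by (rule ga_act_young_symmetrizer[OF assms])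

lemma fiber_perms_cong:
  assumes "\<And>x. x \<in> A \<Longrightarrow> f x = g x"
  shows "fiber_perms f A = fiber_perms g A"
proof -
  have "(\<forall>x. f (p x) = f x) \<longleftrightarrow> (\<forall>x. g (p x) = g x)" if p: "p permutes A" for p
  proof -
    have "f (p x) = f x \<longleftrightarrow> g (p x) = g x" for x
      using assms[of x] assms[of "p x"] permutes_in_image[OF p, of x] permutes_not_in[OF p, of x]
      by (cases "x \<in> A") auto
    then show ?thesis by simp
  qed
  then show ?thesis by (auto simp: fiber_perms_def)
qed

section \<open>Comparison of sorted column lists\<close>

lemma list_all2_insort:
  "list_all2 (\<le>) xs ys \<Longrightarrow> sorted xs \<Longrightarrow> sorted ys \<Longrightarrow> a \<le> b \<Longrightarrow>
    list_all2 (\<le>) (insort a xs) (insort (b :: 'b::linorder) ys)"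
proof (induction xs ys arbitrary: a b rule: list_all2_induct)
  case (Cons x xs y ys)
  show ?case
  proof (cases "a \<le> x \<longleftrightarrow> b \<le> y")
    case True
    then show ?thesis using Cons by auto
  next
    case False
    then consider "a \<le> x" "y < b" | "x < a" "b \<le> y"
      by (auto simp: not_le)
    then show ?thesis
    proof cases
      case 1
      \<comment> \<open>The insertions happen at different depths. Reading \<open>x # xs\<close> as
        the insertion of \<open>x\<close> into \<open>xs\<close> brings the tails into the form of
        the induction hypothesis; the other case is symmetric.\<close>
      then have "list_all2 (\<le>) (insort x xs) (insort b ys)"
        using Cons by (intro Cons.IH) auto
      moreover have "insort x xs = x # xs"
        using Cons.prems by (simp add: insort_is_Cons)
      ultimately show ?thesis using 1 Cons by auto
    next
      case 2
      then have "list_all2 (\<le>) (insort a xs) (insort y ys)"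
        using Cons by (intro Cons.IH) auto
      moreover have "insort y ys = y # ys"
        using Cons.prems by (simp add: insort_is_Cons)
      ultimately show ?thesis using 2 Cons by auto
    qed
  qed
qed auto

lemma sorted_list_of_multiset_image_mono:
  fixes f g :: "'a \<Rightarrow> 'b::linorder"
  assumes "finite B" "\<And>b. b \<in> B \<Longrightarrow> f b \<le> g b"
  shows "list_all2 (\<le>) (sorted_list_of_multiset (image_mset f (mset_set B)))
    (sorted_list_of_multiset (image_mset g (mset_set B)))"
  using assms by (induction B rule: finite_induct) (auto intro!: list_all2_insort)

lemma sum_list_columns: "sum_list (columns X) = (\<Sum>b\<in>X. snd b)"
  by (simp add: columns_def flip: sum_mset_sum_list) (simp add: sum_unfold_sum_mset)

lemma sum_list_all2_le:
  "list_all2 (\<le>) xs ys \<Longrightarrow> sum_list xs \<le> (sum_list ys :: nat)"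
  by (induction rule: list_all2_induct) auto

lemma boxes_le_trans: "boxes_le X Y \<Longrightarrow> boxes_le Y Z \<Longrightarrow> boxes_le X Z"
  unfolding boxes_le_def by (rule list_all2_trans) auto

text \<open>Under entrywise domination, one strict entry amounts to a strict inequality of sums, and
  sums need no sorting.\<close>

lemma boxes_less_iff: "boxes_less X Y \<longleftrightarrow> boxes_le X Y \<and> (\<Sum>b\<in>X. snd b) < (\<Sum>b\<in>Y. snd b)"
proof -
  have "(\<exists>i<length xs. xs ! i < ys ! i) \<longleftrightarrow> sum_list xs < (sum_list ys :: nat)"
    if "list_all2 (\<le>) xs ys" for xs ys
    using that
  proof (induction rule: list_all2_induct)
    case (Cons x xs y ys)
    have "(\<exists>i<length (x # xs). (x # xs) ! i < (y # ys) ! i) \<longleftrightarrow> x < y \<or> (\<exists>i<length xs. xs ! i < ys ! i)"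
      by (auto simp: less_Suc_eq_0_disj)
    then show ?case using Cons sum_list_all2_le[OF Cons(2)] by auto
  qed simp
  then show ?thesis by (auto simp: boxes_less_def boxes_le_def sum_list_columns[symmetric])
qed

section \<open>Column counts, moved tableaux and ideals\<close>

lemma diagram_up: "is_partition l \<Longrightarrow> (i, j) \<in> diagram l \<Longrightarrow> 1 \<le> i' \<Longrightarrow> i' \<le> i \<Longrightarrow> (i', j) \<in> diagram l"
  using part_antimono[of l i' i] by (auto simp: mem_diagram)

lemma initial_segment_iff:
  assumes "finite S" "\<And>j. j \<in> S \<Longrightarrow> 1 \<le> j" "\<And>i j. j \<in> S \<Longrightarrow> 1 \<le> i \<Longrightarrow> i \<le> j \<Longrightarrow> i \<in> S"
  shows "j \<in> S \<longleftrightarrow> 1 \<le> j \<and> j \<le> card S"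
proof (cases "S = {}")
  case False
  have eq: "S = {1..Max S}"
  proof (intro equalityI subsetI)
    show "j \<in> {1..Max S}" if "j \<in> S" for j
      using that assms(2)[OF that] Max_ge[OF assms(1) that] by simp
    show "j \<in> S" if "j \<in> {1..Max S}" for j
      using that by (intro assms(3)[OF Max_in[OF assms(1) False]]) auto
  qed
  have "card S = Max S"
    using arg_cong[OF eq, of card] by simp
  moreover have "j \<in> S \<longleftrightarrow> j \<in> {1..Max S}" by (rule arg_cong[OF eq])
  ultimately show ?thesis by simp
qed (use assms(1) in auto)

text \<open>The conjugate partition: with \<open>m\<close> as column lengths, row \<open>i\<close>
  has one box for each column of length at least \<open>i\<close>, and exactly the rows 1 to
  \<open>m 1\<close> are nonempty.\<close>

lemma partition_of_column_counts:
  assumes anti: "\<And>j. 1 \<le> j \<Longrightarrow> m (Suc j) \<le> m j" and N: "\<And>j. N < j \<Longrightarrow> m j = (0 :: nat)"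
  obtains \<delta> where "is_partition \<delta>" "diagram \<delta> = {(i, j). 1 \<le> i \<and> 1 \<le> j \<and> i \<le> m j}"
proof -
  have mono: "m j' \<le> m j" if "1 \<le> j" "j \<le> j'" for j j'
    using that(2,1) by (induction rule: dec_induct) (auto intro: order_trans[OF anti])
  define S where "S i = {j. 1 \<le> j \<and> i \<le> m j}" for i
  have finS: "finite (S i)" if "1 \<le> i" for i
  proof (rule finite_subset)
    show "S i \<subseteq> {..N}"
    proof
      fix j assume "j \<in> S i"
      then show "j \<in> {..N}" using N[of j] that by (cases "N < j") (auto simp: S_def)
    qed
  qed simp
  have S: "j \<in> S i \<longleftrightarrow> 1 \<le> j \<and> j \<le> card (S i)" if "1 \<le> i" for i j
    by (rule initial_segment_iff[OF finS[OF that]]) (auto simp: S_def intro: order_trans[OF _ mono])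
  define \<delta> where "\<delta> = map (\<lambda>i. card (S i)) [1..<Suc (m 1)]"
  have part: "part \<delta> i = (if 1 \<le> i \<and> i \<le> m 1 then card (S i) else 0)" for i
    by (auto simp: part_def \<delta>_def simp del: upt_Suc)
  have "diagram \<delta> = {(i, j). 1 \<le> i \<and> 1 \<le> j \<and> i \<le> m j}"
  proof (intro set_eqI, clarify)
    fix i j
    show "(i, j) \<in> diagram \<delta> \<longleftrightarrow> (i, j) \<in> {(i, j). 1 \<le> i \<and> 1 \<le> j \<and> i \<le> m j}"
    proof (cases "1 \<le> i \<and> 1 \<le> j")
      case True
      then have "j \<le> card (S i) \<longleftrightarrow> j \<in> S i" using S[of i j] by auto
      moreover have "i \<le> m 1" if "i \<le> m j" using that True mono[of 1 j] by simp
      ultimately show ?thesis using True by (auto simp: mem_diagram part S_def)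
    qed (auto simp: mem_diagram)
  qed
  moreover have "is_partition \<delta>"
    unfolding is_partition_def
  proof
    have "card (S i') \<le> card (S i)" if "1 \<le> i" "i \<le> i'" for i i'
      by (rule card_mono[OF finS]) (use that in \<open>auto simp: S_def\<close>)
    then show "sorted_wrt (\<ge>) \<delta>"
      by (auto simp: \<delta>_def sorted_wrt_iff_nth_less simp del: upt_Suc)
    have "0 \<noteq> card (S i)" if "i \<in> set [1..<Suc (m 1)]" for i
    proof -
      have "1 \<in> S i" "1 \<le> i" using that by (auto simp: S_def)
      then show ?thesis using finS[of i] by auto
    qed
    then show "0 \<notin> set \<delta>" unfolding \<delta>_def set_map by blast
  qed
  ultimately show thesis using that by blast
qed

text \<open>Each column of \<open>X\<close> is pushed to the top. It stays inside the diagram of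
  \<open>l\<close>, whose columns are initial segments at least as long.\<close>

lemma top_justify:
  assumes l: "is_partition l" and X: "X \<subseteq> diagram l" and anti: "antitone_cols snd X"
  obtains \<delta> where "is_partition \<delta>" "diagram \<delta> \<subseteq> diagram l"
    "\<And>j. card {b\<in>diagram \<delta>. snd b = j} = card {b\<in>X. snd b = j}"
proof -
  define m where "m j = card {b\<in>X. snd b = j}" for j
  have fX: "finite X" using X finite_diagram by (rule finite_subset)
  have "m j = 0" if "Max (snd ` X) < j" for j
  proof -
    have "{b\<in>X. snd b = j} = {}" using that Max_ge[of "snd ` X"] fX by fastforce
    then show ?thesis by (simp only: m_def card.empty)
  qed
  then obtain \<delta> where \<delta>: "is_partition \<delta>" "diagram \<delta> = {(i, j). 1 \<le> i \<and> 1 \<le> j \<and> i \<le> m j}"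
    using partition_of_column_counts[of m "Max (snd ` X)"] anti unfolding antitone_cols_def m_def by blast
  have m0: "m 0 = 0"
  proof -
    have "{b\<in>X. snd b = 0} = {}" using X by (auto simp: diagram_def)
    then show ?thesis by (simp only: m_def card.empty)
  qed
  have "card {b\<in>diagram \<delta>. snd b = j} = m j" for j
  proof (cases "j = 0")
    case True
    then have "{b\<in>diagram \<delta>. snd b = j} = {}" by (auto simp: \<delta>(2))
    then have "card {b\<in>diagram \<delta>. snd b = j} = 0" by (simp only: card.empty)
    then show ?thesis using True m0 by simp
  next
    case False
    then have "{b\<in>diagram \<delta>. snd b = j} = (\<lambda>i. (i, j)) ` {1..m j}" by (auto simp: \<delta>(2))
    then have "card {b\<in>diagram \<delta>. snd b = j} = card ((\<lambda>i. (i, j)) ` {1..m j})" by (rule arg_cong)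
    then show ?thesis by (simp add: card_image inj_on_def)
  qed
  moreover have "diagram \<delta> \<subseteq> diagram l"
  proof
    fix b assume "b \<in> diagram \<delta>"
    then obtain i j where b: "b = (i, j)" "1 \<le> i" "i \<le> m j" by (auto simp: \<delta>(2))
    let ?S = "{i. (i, j) \<in> diagram l}"
    have img: "(\<lambda>i. (i, j)) ` ?S = {b\<in>diagram l. snd b = j}" by auto
    have finS: "finite ?S"
      by (rule finite_imageD[of "\<lambda>i. (i, j)"]) (auto simp: img finite_diagram inj_on_def)
    have iff: "i \<in> ?S \<longleftrightarrow> 1 \<le> i \<and> i \<le> card ?S"
    proof (rule initial_segment_iff[OF finS])
      show "1 \<le> i" if "i \<in> ?S" for i using that by (auto simp: mem_diagram)
      show "i' \<in> ?S" if "i \<in> ?S" "1 \<le> i'" "i' \<le> i" for i i'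
        using diagram_up[OF l _ that(2,3)] that(1) by blast
    qed
    moreover have "m j \<le> card {b\<in>diagram l. snd b = j}"
      unfolding m_def using X by (intro card_mono) (auto simp: finite_diagram)
    then have "m j \<le> card ?S"
      unfolding img[symmetric] by (simp add: card_image inj_on_def)
    ultimately have "i \<in> ?S" unfolding iff using b by simp
    then show "b \<in> diagram l" using b by simp
  qed
  ultimately show thesis using that[of \<delta>] \<delta>(1) unfolding m_def by blast
qed

text \<open>Equal counts mean that \<open>(f x, x \<in> X)\<close> and
  \<open>(f x, x \<in> Y)\<close> take the same values on \<open>A\<close> with the same
  multiplicities, so a permutation of \<open>A\<close> matches them. The first component makes it
  preserve fibers, the second makes it carry \<open>X\<close> to \<open>Y\<close>.\<close>

lemma fiber_perms_transitive:
  assumes "finite A" "X \<subseteq> A" "Y \<subseteq> A"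
    and card: "\<And>j. card {x\<in>X. f x = j} = card {x\<in>Y. f x = j}"
  obtains \<pi> where "\<pi> \<in> fiber_perms f A" "\<pi> ` X = Y"
proof -
  have fin: "finite X" "finite Y" using assms by (auto intro: finite_subset)
  have count: "count (image_mset (\<lambda>x. (f x, x \<in> V)) (mset_set A)) (j, b) =
      (if b then card {x\<in>V. f x = j} else card {x\<in>A. f x = j} - card {x\<in>V. f x = j})"
    if V: "V \<subseteq> A" for V j b
  proof -
    have "count (image_mset (\<lambda>x. (f x, x \<in> V)) (mset_set A)) (j, b) = card {x\<in>A. f x = j \<and> (x \<in> V \<longleftrightarrow> b)}"
      using assms(1) by (simp add: count_image_mset' eq_commute[of j] eq_commute[of b])
    also have "{x\<in>A. f x = j \<and> (x \<in> V \<longleftrightarrow> b)} =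
        (if b then {x\<in>V. f x = j} else {x\<in>A. f x = j} - {x\<in>V. f x = j})" using V by auto
    also have "card \<dots> = (if b then card {x\<in>V. f x = j} else card {x\<in>A. f x = j} - card {x\<in>V. f x = j})"
      using V assms(1) by (auto intro!: card_Diff_subset intro: finite_subset)
    finally show ?thesis .
  qed
  have "image_mset (\<lambda>x. (f x, x \<in> X)) (mset_set A) = image_mset (\<lambda>x. (f x, x \<in> Y)) (mset_set A)"
  proof (rule multiset_eqI)
    fix jb :: "'b \<times> bool"
    obtain j b where jb: "jb = (j, b)" by (cases jb)
    show "count (image_mset (\<lambda>x. (f x, x \<in> X)) (mset_set A)) jb = count (image_mset (\<lambda>x. (f x, x \<in> Y)) (mset_set A)) jb"
      unfolding jb count[OF assms(2)] count[OF assms(3)] card ..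
  qed
  from image_mset_eq_implies_permutes[OF assms(1) this] obtain \<pi> where
    \<pi>: "\<pi> permutes A" "\<forall>x\<in>A. (f x, x \<in> X) = (f (\<pi> x), \<pi> x \<in> Y)" by blast
  show thesis
  proof (rule that)
    show "\<pi> \<in> fiber_perms f A" using \<pi> by (intro fiber_permsI[OF \<pi>(1)]) auto
    show "\<pi> ` X = Y"
    proof
      show "\<pi> ` X \<subseteq> Y" using \<pi>(2) assms(2) by auto
      show "Y \<subseteq> \<pi> ` X"
      proof
        fix y assume y: "y \<in> Y"
        then have "inv \<pi> y \<in> A" using assms(3) permutes_in_image[OF permutes_inv[OF \<pi>(1)]] by auto
        moreover have "\<pi> (inv \<pi> y) = y" by (rule permutes_inverses[OF \<pi>(1)])
        ultimately show "y \<in> \<pi> ` X" using \<pi>(2) y by (metis Pair_inject image_eqI)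
      qed
    qed
  qed
qed

text \<open>The filling whose blocks, seen through \<open>T\<close>, are the images under \<rho> of
  those of \<open>F\<close>: the box \<open>b\<close> inherits the value from the box of the label
  that \<rho> sends to \<open>T b\<close>.\<close>

definition move_tableau ::
    "nat list \<Rightarrow> (box \<Rightarrow> 'a) \<Rightarrow> ('a \<Rightarrow> 'a) \<Rightarrow> (box \<Rightarrow> nat) \<Rightarrow> box \<Rightarrow> nat" where
  "move_tableau l T \<rho> F = restrict (\<lambda>b. F (inv_into (diagram l) T (inv \<rho> (T b)))) (diagram l)"

lemma image_preimage_move_tableau:
  assumes T: "bij_betw T (diagram l) A" and \<rho>: "\<rho> permutes A"
  shows "T ` {b\<in>diagram l. move_tableau l T \<rho> F b \<in> I} = \<rho> ` T ` {b\<in>diagram l. F b \<in> I}"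
proof -
  let ?D = "diagram l" and ?U = "inv_into (diagram l) T"
  have TD: "T b \<in> A" if "b \<in> ?D" for b using T that by (auto simp: bij_betw_def)
  have UA: "?U x \<in> ?D" "T (?U x) = x" if "x \<in> A" for x
    using T that by (auto simp: bij_betw_def inv_into_into f_inv_into_f)
  have UT: "?U (T b) = b" if "b \<in> ?D" for b
    using T that by (simp add: bij_betw_inv_into_left)
  have \<rho>A: "\<rho> x \<in> A" "inv \<rho> x \<in> A" if "x \<in> A" for x
    using that permutes_in_image[OF \<rho>] permutes_in_image[OF permutes_inv[OF \<rho>]] by auto
  show ?thesis
  proof (intro equalityI subsetI)
    fix x assume "x \<in> T ` {b\<in>?D. move_tableau l T \<rho> F b \<in> I}"
    then obtain b where b: "b \<in> ?D" "x = T b" "F (?U (inv \<rho> (T b))) \<in> I"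
      by (auto simp: move_tableau_def)
    have "x = \<rho> (T (?U (inv \<rho> (T b))))"
      using b TD UA \<rho>A by (simp add: permutes_inverses[OF \<rho>])
    then show "x \<in> \<rho> ` T ` {b\<in>?D. F b \<in> I}"
      using b UA(1)[OF \<rho>A(2)[OF TD[OF b(1)]]] by blast
  next
    fix x assume "x \<in> \<rho> ` T ` {b\<in>?D. F b \<in> I}"
    then obtain b where b: "b \<in> ?D" "x = \<rho> (T b)" "F b \<in> I" by auto
    then have xA: "x \<in> A" using TD \<rho>A by auto
    have "move_tableau l T \<rho> F (?U x) \<in> I"
      using b UA[OF xA] by (simp add: move_tableau_def permutes_inverses[OF \<rho>] UT)
    then show "x \<in> T ` {b\<in>?D. move_tableau l T \<rho> F b \<in> I}"
      using UA[OF xA] by (intro image_eqI[of _ _ "?U x"]) auto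
  qed
qed

lemma fiber_eq: "fiber l F i = {b\<in>diagram l. F b \<in> {i}}"
  by (simp add: fiber_def)

lemma ga_act_sum_right: "ga_act f (\<Sum>i\<in>I. p i) = (\<Sum>i\<in>I. ga_act f (p i))"
  by (simp add: ga_act_def zact_sum zscale_sum sum.swap[of _ I])

lemma ga_act_scale_right: "ga_act f (zscale c p) = zscale c (ga_act f p)"
  by (simp add: ga_act_def zact_scale zscale_sum zscale_zscale mult.commute)

lemma ysum_zact:
  fixes m :: "('a, 'k::field_char_0) zpoly"
  assumes "is_partition l" "bij_betw T (diagram l) A"
  shows "zp0.ysum (row_of l T) (col_of l T) A (\<lambda>\<sigma>. zact \<sigma> m) \<rho> =
    ga_act (young_symmetrizer l T) (zact \<rho> m)"
  unfolding ga_act_young_symmetrizer[OF assms] zp0.ysum_def by (simp add: zact_comp)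

text \<open>Only the monomial moves, while \<open>T\<close> and its symmetrizer stay. Combinations
  of the \<open>c(T) \<rho>\<close> thus become combinations of tabloid elements for the same
  \<open>T\<close>.\<close>

lemma ysum_zact_move_tableau:
  fixes T :: "box \<Rightarrow> 'a"
  assumes "is_partition l" "bij_betw T (diagram l) A" "\<rho> permutes A"
  shows "(zp0.ysum (row_of l T) (col_of l T) A (\<lambda>\<sigma>. zact \<sigma> (tableau_monomial {1..n} l F T)) \<rho>
      :: ('a, 'k::field_char_0) zpoly) = t_elem n l (move_tableau l T \<rho> F) T"
  unfolding ysum_zact[OF assms(1,2)]
  by (simp only: t_elem_def tableau_monomial_def zact_prod_zvar fiber_eq
      image_preimage_move_tableau[OF assms(2,3)])

section \<open>Generated ideals\<close>

lemma ideal_genI: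
  "(\<And>I. is_ideal d I \<Longrightarrow> (\<And>B. finite B \<Longrightarrow> X B \<subseteq> I B) \<Longrightarrow> p \<in> I A) \<Longrightarrow> p \<in> ideal_gen d X A"
  by (auto simp: ideal_gen_def)

lemma ideal_genD:
  "p \<in> ideal_gen d X A \<Longrightarrow> is_ideal d I \<Longrightarrow> (\<And>B. finite B \<Longrightarrow> X B \<subseteq> I B) \<Longrightarrow> p \<in> I A"
  by (auto simp: ideal_gen_def)

lemma ideal_gen_base: "finite A \<Longrightarrow> p \<in> X A \<Longrightarrow> p \<in> ideal_gen d X A"
  by (rule ideal_genI) blast

lemma ideal_gen_subset:
  assumes "\<And>B. finite B \<Longrightarrow> X B \<subseteq> ideal_gen d Y B"
  shows "ideal_gen d X A \<subseteq> ideal_gen d Y A"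
proof
  fix p assume p: "p \<in> ideal_gen d X A"
  show "p \<in> ideal_gen d Y A"
  proof (rule ideal_genI)
    fix I assume I: "is_ideal d I" "\<And>B. finite B \<Longrightarrow> Y B \<subseteq> I B"
    show "p \<in> I A"
    proof (rule ideal_genD[OF p I(1)])
      show "X B \<subseteq> I B" if "finite B" for B
      proof
        fix q assume "q \<in> X B"
        then have "q \<in> ideal_gen d Y B" using assms[OF that] by blast
        then show "q \<in> I B" by (rule ideal_genD[OF _ I])
      qed
    qed
  qed
qed

lemma ideal_gen_subspace:
  assumes "finite A"
  shows "zp.subspace (ideal_gen d X A)"
proof -
  have "zp.subspace (I A)" if "is_ideal d I" for I
    using that assms by (simp add: is_ideal_def)
  then show ?thesis
    unfolding ideal_gen_def by (intro zp.subspace_Inter) auto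
qed

lemma ideal_gen_mult:
  assumes "finite A" "finite B" "A \<inter> B = {}" "p \<in> ideal_gen d X A" "q \<in> S_space d B"
  shows "p * q \<in> ideal_gen d X (A \<union> B)"
proof (rule ideal_genI)
  fix I assume I: "is_ideal d I" "\<And>B. finite B \<Longrightarrow> X B \<subseteq> I B"
  then have "p \<in> I A" by (rule ideal_genD[OF assms(4)])
  moreover have "\<forall>A B. finite A \<longrightarrow> finite B \<longrightarrow> A \<inter> B = {} \<longrightarrow>
      (\<forall>p\<in>I A. \<forall>q\<in>S_space d B. p * q \<in> I (A \<union> B))"
    using I(1) by (simp add: is_ideal_def)
  ultimately show "p * q \<in> I (A \<union> B)" using assms by simp
qed

lemma ideal_gen_zact:
  assumes "finite A" "\<phi> permutes A" "p \<in> ideal_gen d X A"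
  shows "zact \<phi> p \<in> ideal_gen d X A"
proof (rule ideal_genI)
  fix I assume I: "is_ideal d I" "\<And>B. finite B \<Longrightarrow> X B \<subseteq> I B"
  then have "p \<in> I A" by (rule ideal_genD[OF assms(3)])
  moreover have "\<forall>A A' \<phi>. finite A \<longrightarrow> bij_betw \<phi> A A' \<longrightarrow> zact \<phi> ` I A \<subseteq> I A'"
    using I(1) by (simp add: is_ideal_def)
  from this[rule_format, OF assms(1) permutes_imp_bij[OF assms(2)]]
  have "zact \<phi> ` I A \<subseteq> I A" .
  ultimately show "zact \<phi> p \<in> I A" by blast
qed

lemma ideal_gen_young_symmetrizer:
  fixes p :: "('a, 'k::field_char_0) zpoly"
  assumes "is_partition l" and T: "bij_betw T (diagram l) A" and p: "p \<in> ideal_gen d X A"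
  shows "ga_act (young_symmetrizer l T) p \<in> ideal_gen d X A"
proof -
  have fA: "finite A" using T finite_diagram by (metis bij_betw_finite)
  have "zact (\<sigma> \<circ> \<tau> \<circ> id) p \<in> ideal_gen d X A"
    if "\<sigma> \<in> fiber_perms (row_of l T) A" "\<tau> \<in> fiber_perms (col_of l T) A" for \<sigma> \<tau>
    using that by (intro ideal_gen_zact[OF fA _ p]) (auto simp: fiber_perms_def permutes_compose)
  then show ?thesis
    unfolding ga_act_young_symmetrizer[OF assms(1,2)] zp0.ysum_def
    by (intro zp.subspace_sum zp.subspace_scale ideal_gen_subspace fA)
qed

section \<open>The decomposition of a tabloid\<close>

lemma tableau_monomial_in_S_space:
  fixes T :: "box \<Rightarrow> 'a"
  assumes "0 < d" and T: "inj_on T (diagram l)" and card: "\<And>i. i \<in> I \<Longrightarrow> card (fiber l F i) = d"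
    and A: "A = T ` {b\<in>diagram l. F b \<in> I}"
  shows "(tableau_monomial I l F T :: ('a, 'k::field) zpoly) \<in> S_space d A"
proof -
  let ?X = "\<lambda>i. T ` fiber l F i"
  have sub: "fiber l F i \<subseteq> diagram l" for i by (auto simp: fiber_def)
  have cardX: "card (?X i) = d" if "i \<in> I" for i
    using card[OF that] T sub by (simp add: card_image inj_on_subset)
  have ne: "?X i \<noteq> {}" if "i \<in> I" for i
    using cardX[OF that] assms(1) by auto
  have disj: "?X i \<inter> ?X j = {}" if "i \<noteq> j" for i j
    using that T by (auto simp: fiber_def dest: inj_onD)
  have inj: "inj_on ?X I"
  proof (rule inj_onI)
    fix i j assume "i \<in> I" "j \<in> I" "?X i = ?X j"
    then show "i = j" using disj[of i j] ne by (metis Int_absorb)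
  qed
  have "partition_on A (?X ` I)"
  proof (rule partition_onI)
    show "\<Union> (?X ` I) = A" by (auto simp: A fiber_def)
    show "disjnt p q" if pq: "p \<in> ?X ` I" "q \<in> ?X ` I" "p \<noteq> q" for p q
    proof -
      obtain i j where "p = ?X i" "q = ?X j" using pq by blast
      then show ?thesis using pq(3) disj[of i j] unfolding disjnt_def by metis
    qed
    show "{} \<notin> ?X ` I" using ne by fastforce
  qed
  moreover have "(tableau_monomial I l F T :: ('a, 'k) zpoly) = (\<Prod>X\<in>?X ` I. zvar X)"
    unfolding tableau_monomial_def by (simp add: prod.reindex[OF inj])
  ultimately show ?thesis
    unfolding S_space_def using cardX by (intro zp.span_base) blast
qed

text \<open>The element is \<open>c(T) c(S) z\<close>. The factor \<open>c(S)\<close> turns the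
  first \<open>k\<close> blocks of \<open>z\<close> into a generator on \<open>P\<close>, the other
  blocks form a monomial on \<open>A - P\<close>, and ideals are stable under
  \<open>c(T)\<close>.\<close>

lemma initial_symmetrizer_in_ideal:
  fixes T :: "box \<Rightarrow> 'a"
  assumes "k \<le> n" "0 < d" "is_partition la" "is_partition \<mu>" "diagram \<mu> \<subseteq> diagram la"
    and F: "young_dn_tableau d n la F" and init: "initial_boxes k la F = diagram \<mu>"
    and T: "bij_betw T (diagram la) A"
  defines "P \<equiv> T ` diagram \<mu>" and "r \<equiv> row_of la T" and "c \<equiv> col_of la T"
  shows "(\<Sum>p\<in>fiber_perms r P. zp0.alt_ysum r c A P
      (\<lambda>\<sigma>. zact \<sigma> (tableau_monomial {1..n} la F T)) p :: ('a, 'k::field_char_0) zpoly) \<in>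
    ideal_gen d (tabloid k \<mu> (restrict F (diagram \<mu>))) A"
proof -
  let ?F0 = "restrict F (diagram \<mu>)"
  let ?m = "tableau_monomial {1..n} la F T :: ('a, 'k) zpoly"
  let ?m1 = "tableau_monomial {1..k} la F T :: ('a, 'k) zpoly"
  let ?m2 = "tableau_monomial {k<..n} la F T :: ('a, 'k) zpoly"
  have inj: "inj_on T (diagram la)" and A: "A = T ` diagram la"
    using T by (auto simp: bij_betw_def)
  have fA: "finite A" by (simp add: A finite_diagram)
  have PA: "P \<subseteq> A" using assms(5) by (auto simp: P_def A)
  have fP: "finite P" using PA fA by (rule finite_subset)
  have T\<mu>: "bij_betw T (diagram \<mu>) P"
    using inj_on_subset[OF inj assms(5)] by (simp add: bij_betw_def P_def)
  have Frange: "F b \<in> {1..n}" if "b \<in> diagram la" for b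
    using F that by (auto simp: young_dn_tableau_def)
  have m: "?m = ?m1 * ?m2"
  proof -
    have eq: "{1..n} = {1..k} \<union> {k<..n}" using assms(1) by auto
    show ?thesis
      unfolding tableau_monomial_def eq by (rule prod.union_disjoint) auto
  qed
  have zact_m: "zact g ?m = zact g ?m1 * ?m2" if g: "g permutes P" for g
  proof -
    have "g ` T ` fiber la F i = T ` fiber la F i" if i: "i \<in> {k<..n}" for i
    proof -
      have "g (T b) = T b" if b: "b \<in> fiber la F i" for b
      proof (rule permutes_not_in[OF g])
        have "b \<notin> diagram \<mu>" using b i by (auto simp: fiber_def initial_boxes_def simp flip: init)
        then show "T b \<notin> P"
          using b assms(5) inj by (auto simp: P_def fiber_def dest: inj_onD)
      qed
      then show ?thesis by (simp add: image_image)
    qed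
    then have "(\<Prod>i\<in>{k<..n}. zvar (g ` T ` fiber la F i)) = ?m2"
      by (simp add: tableau_monomial_def)
    then have "zact g ?m1 * ?m2 = (\<Prod>i\<in>{1..k} \<union> {k<..n}. zvar (g ` T ` fiber la F i))"
      by (subst prod.union_disjoint) (auto simp: tableau_monomial_def zact_prod_zvar)
    also have "{1..k} \<union> {k<..n} = {1..n}" using assms(1) by auto
    finally show ?thesis by (simp add: tableau_monomial_def zact_prod_zvar)
  qed
  have rc: "row_of \<mu> T x = r x" "col_of \<mu> T x = c x" if "x \<in> P" for x
    using that row_col_of_apply[OF T\<mu>] row_col_of_apply[OF T] assms(5)
    by (auto simp: P_def r_def c_def)
  have fib: "fiber \<mu> ?F0 i = fiber la F i" if "i \<in> {1..k}" for i
    using that assms(5) by (auto simp: fiber_def initial_boxes_def simp flip: init)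
  have t: "t_elem k \<mu> ?F0 T = (\<Sum>p\<in>fiber_perms r P. \<Sum>h\<in>fiber_perms c P.
      zscale (of_int (sign h)) (zact (p \<circ> h) ?m1))"
  proof -
    have "tableau_monomial {1..k} \<mu> ?F0 T = ?m1"
      unfolding tableau_monomial_def by (rule prod.cong) (simp_all add: fib)
    then show ?thesis
      unfolding t_elem_ysum[OF assms(4) T\<mu>] zp0.ysum_def
      by (simp add: fiber_perms_cong[of P "row_of \<mu> T" r] fiber_perms_cong[of P "col_of \<mu> T" c] rc)
  qed
  have "(\<Sum>p\<in>fiber_perms r P. zp0.alt_ysum r c A P (\<lambda>\<sigma>. zact \<sigma> ?m) p) =
      ga_act (young_symmetrizer la T) (\<Sum>p\<in>fiber_perms r P. \<Sum>h\<in>fiber_perms c P.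
        zscale (of_int (sign h)) (zact (p \<circ> h) ?m))"
    unfolding zp0.alt_ysum_def r_def c_def ysum_zact[OF assms(3) T]
    by (simp add: ga_act_sum_right ga_act_scale_right)
  also have "(\<Sum>p\<in>fiber_perms r P. \<Sum>h\<in>fiber_perms c P.
        zscale (of_int (sign h)) (zact (p \<circ> h) ?m)) = t_elem k \<mu> ?F0 T * ?m2"
    unfolding t sum_distrib_right
  proof (intro sum.cong refl)
    fix p h assume "p \<in> fiber_perms r P" "h \<in> fiber_perms c P"
    then have "p \<circ> h permutes P" by (simp add: fiber_perms_def permutes_compose)
    then show "zscale (of_int (sign h)) (zact (p \<circ> h) ?m) =
        zscale (of_int (sign h)) (zact (p \<circ> h) ?m1) * ?m2"
      by (simp only: zact_m zscale_mult_left)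
  qed
  also have "ga_act (young_symmetrizer la T) \<dots> \<in> ideal_gen d (tabloid k \<mu> ?F0) A"
  proof (rule ideal_gen_young_symmetrizer[OF assms(3) T])
    have "t_elem k \<mu> ?F0 T \<in> ideal_gen d (tabloid k \<mu> ?F0) P"
      using T\<mu> by (intro ideal_gen_base fP) (auto simp: tabloid_def)
    moreover have "?m2 \<in> S_space d (A - P)"
    proof (rule tableau_monomial_in_S_space[OF assms(2) inj])
      show "card (fiber la F i) = d" if "i \<in> {k<..n}" for i
        using F that by (auto simp: young_dn_tableau_def)
      have "{b\<in>diagram la. F b \<in> {k<..n}} = diagram la - diagram \<mu>"
        using Frange by (fastforce simp: initial_boxes_def simp flip: init)
      then show "A - P = T ` {b\<in>diagram la. F b \<in> {k<..n}}"
        using inj_on_image_set_diff[OF inj, of "diagram la" "diagram \<mu>"] assms(5)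
        by (simp add: A P_def)
    qed
    ultimately have "t_elem k \<mu> ?F0 T * ?m2 \<in> ideal_gen d (tabloid k \<mu> ?F0) (P \<union> (A - P))"
      using fP fA by (intro ideal_gen_mult) auto
    then show "t_elem k \<mu> ?F0 T * ?m2 \<in> ideal_gen d (tabloid k \<mu> ?F0) A"
      using PA by (simp add: Un_absorb1)
  qed
  finally show ?thesis .
qed

lemma columns_le_of_bij:
  assumes "finite B" "inj_on \<theta> B" "\<And>b. b \<in> B \<Longrightarrow> snd (\<theta> b) \<le> snd b"
  shows "boxes_le (\<theta> ` B) B"
proof -
  have "image_mset snd (mset_set (\<theta> ` B)) = image_mset (\<lambda>b. snd (\<theta> b)) (mset_set B)"
    by (simp add: image_mset_mset_set[OF assms(2), symmetric] multiset.map_comp comp_def)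
  then show ?thesis
    unfolding boxes_le_def columns_def
    using sorted_list_of_multiset_image_mono[OF assms(1), of "\<lambda>b. snd (\<theta> b)" snd] assms(3) by simp
qed

lemma move_tableau_smaller:
  assumes "k \<le> n" and F: "young_dn_tableau d n la F" and init: "initial_boxes k la F = diagram \<mu>"
    and T: "bij_betw T (diagram la) A" and \<rho>: "\<rho> permutes A"
    and le: "\<And>b. b \<in> diagram \<mu> \<Longrightarrow> col_of la T (\<rho> (T b)) \<le> snd b"
    and less: "\<exists>b\<in>diagram \<mu>. col_of la T (\<rho> (T b)) < snd b"
    and \<delta>: "is_partition \<delta>" "diagram \<delta> \<subseteq> diagram la" "\<rho> ` T ` diagram \<mu> = T ` diagram \<delta>"
  shows "move_tableau la T \<rho> F \<in> smaller_tableaux d n k la F"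
proof -
  let ?G = "move_tableau la T \<rho> F" and ?D = "diagram la"
  let ?U = "inv_into (diagram la) T"
  have inj: "inj_on T ?D" and A: "A = T ` ?D" using T by (auto simp: bij_betw_def)
  define \<theta> where "\<theta> b = ?U (\<rho> (T b))" for b
  have \<theta>: "\<theta> b \<in> ?D" "T (\<theta> b) = \<rho> (T b)" if "b \<in> ?D" for b
  proof -
    have "\<rho> (T b) \<in> T ` ?D" using that permutes_in_image[OF \<rho>] by (simp add: A)
    then show "\<theta> b \<in> ?D" "T (\<theta> b) = \<rho> (T b)"
      by (simp_all add: \<theta>_def inv_into_into f_inv_into_f)
  qed
  have inj\<theta>: "inj_on \<theta> ?D"
    by (rule inj_onI) (metis \<theta>(2) inj inj_onD permutes_inj[OF \<rho>] injD)
  have image: "{b\<in>?D. ?G b \<in> I} = \<theta> ` {b\<in>?D. F b \<in> I}" for I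
  proof -
    have "T ` {b\<in>?D. ?G b \<in> I} = T ` \<theta> ` {b\<in>?D. F b \<in> I}"
      unfolding image_preimage_move_tableau[OF T \<rho>] image_image
      by (rule image_cong) (auto simp: \<theta>)
    then show ?thesis
      by (subst (asm) inj_on_image_eq_iff[OF inj]) (auto simp: \<theta>)
  qed
  have fib: "fiber la ?G i = \<theta> ` fiber la F i" for i
    unfolding fiber_eq by (rule image)
  have snd\<theta>: "snd (\<theta> b) = col_of la T (\<rho> (T b))" for b
    by (simp add: \<theta>_def col_of_def)
  have fib_init: "fiber la F i \<subseteq> diagram \<mu>" if "i \<in> {1..k}" for i
    using that by (auto simp: fiber_def initial_boxes_def simp flip: init)
  have injF: "inj_on \<theta> (fiber la F i)" for i
    by (rule inj_on_subset[OF inj\<theta>]) (auto simp: fiber_def)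
  have le_i: "boxes_le (fiber la ?G i) (fiber la F i)" if "i \<in> {1..k}" for i
    unfolding fib using le fib_init[OF that]
    by (intro columns_le_of_bij finite_fiber injF) (auto simp: snd\<theta>)
  have "\<exists>i\<in>{1..k}. boxes_less (fiber la ?G i) (fiber la F i)"
  proof -
    obtain b where b: "b \<in> diagram \<mu>" "snd (\<theta> b) < snd b" using less by (auto simp: snd\<theta>)
    then have i: "F b \<in> {1..k}" "b \<in> fiber la F (F b)"
      by (auto simp: fiber_def initial_boxes_def simp flip: init)
    have "(\<Sum>x\<in>fiber la ?G (F b). snd x) = (\<Sum>x\<in>fiber la F (F b). snd (\<theta> x))"
      unfolding fib by (simp add: sum.reindex[OF injF])
    also have "\<dots> < (\<Sum>x\<in>fiber la F (F b). snd x)"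
      using b i le fib_init[OF i(1)]
      by (intro sum_strict_mono_ex1 finite_fiber) (auto simp: snd\<theta>)
    finally show ?thesis using i le_i by (auto simp: boxes_less_iff)
  qed
  moreover have "young_dn_tableau d n la ?G"
    unfolding young_dn_tableau_def
  proof
    have "{b\<in>?D. ?G b \<in> {1..n}} = \<theta> ` {b\<in>?D. F b \<in> {1..n}}" by (rule image)
    also have "{b\<in>?D. F b \<in> {1..n}} = ?D" using F by (auto simp: young_dn_tableau_def)
    also have "\<theta> ` ?D = ?D"
      using \<theta>(1) by (intro endo_inj_surj inj\<theta> finite_diagram) auto
    finally have "?G b \<in> {1..n}" if "b \<in> ?D" for b using that by blast
    then show "?G \<in> ?D \<rightarrow>\<^sub>E {1..n}" by (intro PiE_I) (auto simp: move_tableau_def)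
    show "\<forall>i\<in>{1..n}. card (fiber la ?G i) = d"
      using F by (simp add: fib card_image[OF injF] young_dn_tableau_def)
  qed
  moreover have "initial_boxes k la ?G = diagram \<delta>"
  proof -
    have "T ` initial_boxes k la ?G = T ` diagram \<delta>"
      unfolding \<delta>(3)[symmetric] init[symmetric] initial_boxes_def
      by (rule image_preimage_move_tableau[OF T \<rho>])
    then show ?thesis
      by (subst (asm) inj_on_image_eq_iff[OF inj]) (use \<delta>(2) in \<open>auto simp: initial_boxes_def\<close>)
  qed
  ultimately show ?thesis using le_i \<delta> by (auto simp: smaller_tableaux_def)
qed

text \<open>The correction terms keep \<open>T\<close> and change only the filling, so the result
  can be iterated for a fixed \<open>T\<close>.\<close>

lemma t_elem_decomposition:
  fixes T :: "box \<Rightarrow> 'a"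
  assumes "k \<le> n" "0 < d" "is_partition la" "is_partition \<mu>" "diagram \<mu> \<subseteq> diagram la"
    and F: "young_dn_tableau d n la F" and init: "initial_boxes k la F = diagram \<mu>"
    and T: "bij_betw T (diagram la) A"
  obtains w where "w \<in> ideal_gen d (tabloid k \<mu> (restrict F (diagram \<mu>))) A"
    "(t_elem n la F T :: ('a, 'k::field_char_0) zpoly) - w \<in>
      zp.span ((\<lambda>G. t_elem n la G T) ` smaller_tableaux d n k la F)"
proof -
  let ?r = "row_of la T" and ?c = "col_of la T" and ?P = "T ` diagram \<mu>"
  let ?\<Phi> = "\<lambda>\<sigma>. zact \<sigma> (tableau_monomial {1..n} la F T) :: ('a, 'k) zpoly"
  let ?S = "(\<lambda>G. t_elem n la G T :: ('a, 'k) zpoly) ` smaller_tableaux d n k la F"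
  have inj: "inj_on T (diagram la)" and A: "A = T ` diagram la" using T by (auto simp: bij_betw_def)
  have fA: "finite A" by (simp add: A finite_diagram)
  have PA: "?P \<subseteq> A" using assms(5) by (auto simp: A)
  have yA: "young_set ?r ?c A" by (rule young_set_tableau[OF T])
  have yP: "young_set ?r ?c ?P"
  proof -
    have T\<mu>: "bij_betw T (diagram \<mu>) ?P"
      using inj_on_subset[OF inj assms(5)] by (simp add: bij_betw_def)
    have "row_of \<mu> T x = ?r x" "col_of \<mu> T x = ?c x" if "x \<in> ?P" for x
      using that row_col_of_apply[OF T\<mu>] row_col_of_apply[OF T] assms(5) by auto
    then show ?thesis
      using young_set_tableau[OF T\<mu>] unfolding young_set_def
      by (simp cong: inj_on_cong ball_cong bex_cong conj_cong)
  qed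
  obtain \<beta> where \<beta>: "zp0.ysum ?r ?c A ?\<Phi> id -
      zscale \<beta> (\<Sum>p\<in>fiber_perms ?r ?P. zp0.alt_ysum ?r ?c A ?P ?\<Phi> p) \<in>
    zp.span (zp0.ysum ?r ?c A ?\<Phi> ` {\<tau>. \<tau> permutes A \<and> (\<forall>b\<in>?P. ?c (\<tau> b) \<le> ?c b) \<and>
      (\<exists>b\<in>?P. ?c (\<tau> b) < ?c b) \<and> antitone_cols ?c (\<tau> ` ?P)})"
    (is "_ \<in> zp.span (_ ` ?M)")
    using zp0.ysum_straighten[OF yA yP PA, of 1 ?\<Phi>] by auto
  have "zp0.ysum ?r ?c A ?\<Phi> \<tau> \<in> zp.span ?S" if \<tau>: "\<tau> \<in> ?M" for \<tau>
  proof -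
    have perm: "\<tau> permutes A" using \<tau> by simp
    have \<tau>P: "\<tau> ` ?P \<subseteq> A" using image_mono[OF PA, of \<tau>] by (simp only: permutes_image[OF perm])
    \<comment> \<open>The boxes occupied by \<open>P\<close> after \<tau>. They need not form a
      diagram, but have the column counts of one.\<close>
    define X where "X = {b\<in>diagram la. T b \<in> \<tau> ` ?P}"
    have TX: "T ` X = \<tau> ` ?P"
    proof -
      have "T ` {b\<in>diagram la. T b \<in> Q} = T ` diagram la \<inter> Q" for Q by auto
      then show ?thesis using \<tau>P unfolding X_def A by (simp only: Int_absorb1)
    qed
    have cnt: "card {x\<in>T ` Y. ?c x = j} = card {b\<in>Y. snd b = j}" if "Y \<subseteq> diagram la" for Y j
    proof -
      have "{x\<in>T ` Y. ?c x = j} = T ` {b\<in>Y. snd b = j}"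
        using that row_col_of_apply(2)[OF T] by auto
      moreover have "inj_on T {b\<in>Y. snd b = j}"
        using that by (intro inj_on_subset[OF inj]) auto
      ultimately show ?thesis by (simp add: card_image)
    qed
    have X: "X \<subseteq> diagram la" by (auto simp: X_def)
    have "antitone_cols snd X"
      using \<tau> by (simp add: antitone_cols_def TX[symmetric] cnt[OF X])
    then obtain \<delta> where \<delta>: "is_partition \<delta>" "diagram \<delta> \<subseteq> diagram la"
      "\<And>j. card {b\<in>diagram \<delta>. snd b = j} = card {b\<in>X. snd b = j}"
      using top_justify[OF assms(3) X] by blast
    have \<delta>A: "T ` diagram \<delta> \<subseteq> A" unfolding A by (rule image_mono[OF \<delta>(2)])
    have "card {x\<in>\<tau> ` ?P. ?c x = j} = card {x\<in>T ` diagram \<delta>. ?c x = j}" for j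
      by (simp only: TX[symmetric] cnt[OF X] cnt[OF \<delta>(2)] \<delta>(3))
    \<comment> \<open>Passing from this region to the diagram of \<delta> is a column permutation:
      it costs a sign and leaves all column inequalities intact.\<close>
    from fiber_perms_transitive[OF fA \<tau>P \<delta>A this]
    obtain \<pi> where \<pi>: "\<pi> \<in> fiber_perms ?c A" "\<pi> ` \<tau> ` ?P = T ` diagram \<delta>" by blast
    have perm': "\<pi> \<circ> \<tau> permutes A"
      by (rule permutes_compose[OF perm fiber_perms_permutes[OF \<pi>(1)]])
    have c\<pi>: "?c (\<pi> x) = ?c x" for x using \<pi>(1) by (simp add: fiber_perms_def)
    have cb: "?c (T b) = snd b" if "b \<in> diagram \<mu>" for b
      using row_col_of_apply(2)[OF T subsetD[OF assms(5) that]] .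
    have "move_tableau la T (\<pi> \<circ> \<tau>) F \<in> smaller_tableaux d n k la F"
    proof (rule move_tableau_smaller[OF assms(1) F init T perm' _ _ \<delta>(1,2)])
      show "?c ((\<pi> \<circ> \<tau>) (T b)) \<le> snd b" if "b \<in> diagram \<mu>" for b
        using \<tau> that cb[OF that] by (auto simp: c\<pi>)
      show "\<exists>b\<in>diagram \<mu>. ?c ((\<pi> \<circ> \<tau>) (T b)) < snd b"
        using \<tau> cb by (auto simp: c\<pi>)
      show "(\<pi> \<circ> \<tau>) ` ?P = T ` diagram \<delta>" using \<pi>(2) by (simp add: image_comp)
    qed
    then have "zp0.ysum ?r ?c A ?\<Phi> (\<pi> \<circ> \<tau>) \<in> zp.span ?S"
      unfolding ysum_zact_move_tableau[OF assms(3) T perm'] by (intro zp.span_base) auto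
    then have "zscale (of_int (sign \<pi>)) (zp0.ysum ?r ?c A ?\<Phi> \<tau>) \<in> zp.span ?S"
      by (simp only: zp0.ysum_col_left[OF fA \<pi>(1)])
    then show ?thesis by (rule zp0.span_scale_cancel) (simp add: sign_def)
  qed
  then have "zp.span (zp0.ysum ?r ?c A ?\<Phi> ` ?M) \<subseteq> zp.span ?S"
    by (intro zp.span_minimal zp.subspace_span) blast
  with \<beta> have "t_elem n la F T - zscale \<beta> (\<Sum>p\<in>fiber_perms ?r ?P. zp0.alt_ysum ?r ?c A ?P ?\<Phi> p) \<in> zp.span ?S"
    unfolding t_elem_ysum[OF assms(3) T] by blast
  moreover have "zscale \<beta> (\<Sum>p\<in>fiber_perms ?r ?P. zp0.alt_ysum ?r ?c A ?P ?\<Phi> p) \<in>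
      ideal_gen d (tabloid k \<mu> (restrict F (diagram \<mu>))) A"
    by (intro zp.subspace_scale ideal_gen_subspace fA initial_symmetrizer_in_ideal assms)
  ultimately show thesis using that by blast
qed

section \<open>Iterating the decomposition\<close>

lemma smaller_tableaux_trans:
  assumes G: "G \<in> smaller_tableaux d n k la F" and H: "H \<in> smaller_tableaux d n k la G"
  shows "H \<in> smaller_tableaux d n k la F"
proof -
  have le: "boxes_le (fiber la H i) (fiber la F i)" if "i \<in> {1..k}" for i
  proof (rule boxes_le_trans)
    show "boxes_le (fiber la H i) (fiber la G i)" "boxes_le (fiber la G i) (fiber la F i)"
      using G H that by (auto simp: smaller_tableaux_def)
  qed
  obtain i where i: "i \<in> {1..k}" "boxes_less (fiber la G i) (fiber la F i)"
    using G by (auto simp: smaller_tableaux_def)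
  have "boxes_le (fiber la H i) (fiber la G i)" using H i(1) by (auto simp: smaller_tableaux_def)
  then have "(\<Sum>b\<in>fiber la H i. snd b) \<le> (\<Sum>b\<in>fiber la G i. snd b)"
    unfolding boxes_le_def sum_list_columns[symmetric] by (rule sum_list_all2_le)
  then have "boxes_less (fiber la H i) (fiber la F i)"
    using i le by (auto simp: boxes_less_iff)
  then show ?thesis using H le i(1) by (auto simp: smaller_tableaux_def)
qed

lemma smaller_tableaux_weight:
  assumes "G \<in> smaller_tableaux d n k la F"
  shows "(\<Sum>i\<in>{1..k}. \<Sum>b\<in>fiber la G i. snd b) < (\<Sum>i\<in>{1..k}. \<Sum>b\<in>fiber la F i. snd b)"
proof (rule sum_strict_mono_ex1)
  show "\<forall>i\<in>{1..k}. (\<Sum>b\<in>fiber la G i. snd b) \<le> (\<Sum>b\<in>fiber la F i. snd b)"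
    using assms
    by (auto simp: smaller_tableaux_def boxes_le_def sum_list_columns[symmetric] intro: sum_list_all2_le)
  show "\<exists>i\<in>{1..k}. (\<Sum>b\<in>fiber la G i. snd b) < (\<Sum>b\<in>fiber la F i. snd b)"
    using assms by (auto simp: smaller_tableaux_def boxes_less_iff)
qed simp

text \<open>The small region of \<open>G\<close> is again a diagram, so the decomposition applies
  with \<open>G\<close> in the role of \<open>F\<close>. The new correction terms are smaller than
  \<open>G\<close>, hence smaller than \<open>F\<close>, and have a smaller column sum.\<close>

lemma t_elem_in_initial_ideal:
  fixes T :: "box \<Rightarrow> 'a"
  assumes "k \<le> n" "0 < d" "is_partition la" and T: "bij_betw T (diagram la) A"
    and "G \<in> smaller_tableaux d n k la F"
  shows "(t_elem n la G T :: ('a, 'k::field_char_0) zpoly) \<in>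
    ideal_gen d (\<lambda>B. \<Union>G\<in>smaller_tableaux d n k la F. initial_tabloid k la G B) A"
  using assms(5)
proof (induction "\<Sum>i\<in>{1..k}. \<Sum>b\<in>fiber la G i. snd b" arbitrary: G rule: less_induct)
  case less
  let ?X = "\<lambda>B. \<Union>G\<in>smaller_tableaux d n k la F. initial_tabloid k la G B :: ('a, 'k) zpoly set"
  have fA: "finite A" using T finite_diagram by (metis bij_betw_finite)
  obtain \<delta> where \<delta>: "is_partition \<delta>" "diagram \<delta> \<subseteq> diagram la" "initial_boxes k la G = diagram \<delta>"
    and G: "young_dn_tableau d n la G"
    using less.prems by (auto simp: smaller_tableaux_def)
  obtain w :: "('a, 'k) zpoly" where
    w: "w \<in> ideal_gen d (tabloid k \<delta> (restrict G (diagram \<delta>))) A" and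
    span: "t_elem n la G T - w \<in> zp.span ((\<lambda>G. t_elem n la G T) ` smaller_tableaux d n k la G)"
    by (rule t_elem_decomposition[OF assms(1-3) \<delta>(1,2) G \<delta>(3) T])
  have "ideal_gen d (tabloid k \<delta> (restrict G (diagram \<delta>))) A \<subseteq> ideal_gen d ?X A"
  proof (rule ideal_gen_subset)
    fix B :: "'a set" assume "finite B"
    have "tabloid k \<delta> (restrict G (diagram \<delta>)) B \<subseteq> ?X B"
      using \<delta> less.prems unfolding initial_tabloid_def by blast
    then show "tabloid k \<delta> (restrict G (diagram \<delta>)) B \<subseteq> ideal_gen d ?X B"
      using ideal_gen_base[OF \<open>finite B\<close>, of _ ?X] by blast
  qed
  with w have "w \<in> ideal_gen d ?X A" by blast
  moreover have "zp.span ((\<lambda>G. t_elem n la G T) ` smaller_tableaux d n k la G) \<subseteq> ideal_gen d ?X A"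
  proof (intro zp.span_minimal ideal_gen_subspace fA image_subsetI)
    fix H assume "H \<in> smaller_tableaux d n k la G"
    then show "t_elem n la H T \<in> ideal_gen d ?X A"
      using less.hyps smaller_tableaux_weight smaller_tableaux_trans less.prems by blast
  qed
  ultimately have "w + (t_elem n la G T - w) \<in> ideal_gen d ?X A"
    using span by (intro zp.subspace_add ideal_gen_subspace fA) auto
  then show ?case by simp
qed

theorem theorem3p4:
  fixes k n d :: nat and la \<mu> :: "nat list" and F :: "box \<Rightarrow> nat"
  assumes "0 < k" and "k \<le> n" and "0 < d"
    and "is_partition la" and "sum_list la = n * d"
    and "is_partition \<mu>" and "sum_list \<mu> = k * d"
    and "diagram \<mu> \<subseteq> diagram la"
    and "young_dn_tableau d n la F"
    and "initial_boxes k la F = diagram \<mu>"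
  shows "(\<forall>A :: 'a set. (tabloid n la F A :: ('a, 'k::field_char_0) zpoly set) \<subseteq>
            ideal_sum
              (ideal_gen d (tabloid k \<mu> (restrict F (diagram \<mu>))))
              (ideal_gen d (\<lambda>B. \<Union>G\<in>smaller_tableaux d n k la F. tabloid n la G B)) A) \<and>
         (\<forall>A :: 'a set. (tabloid n la F A :: ('a, 'k) zpoly set) \<subseteq>
            ideal_sum
              (ideal_gen d (tabloid k \<mu> (restrict F (diagram \<mu>))))
              (ideal_gen d (\<lambda>B. \<Union>G\<in>smaller_tableaux d n k la F. initial_tabloid k la G B)) A)"
proof -
  \<comment> \<open>The generating family \<open>X\<close> is left open, since the two inclusions
    differ only in it.\<close>
  have in_sum: "t_elem n la F T \<in> ideal_sum (ideal_gen d (tabloid k \<mu> (restrict F (diagram \<mu>)))) (ideal_gen d X) A"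
    if T: "bij_betw T (diagram la) A"
      and X: "\<And>G. G \<in> smaller_tableaux d n k la F \<Longrightarrow> t_elem n la G T \<in> ideal_gen d X A"
    for A :: "'a set" and T and X :: "('a, 'k) family"
  proof -
    have fA: "finite A" using T finite_diagram by (metis bij_betw_finite)
    obtain w :: "('a, 'k) zpoly" where
      w: "w \<in> ideal_gen d (tabloid k \<mu> (restrict F (diagram \<mu>))) A" and
      span: "t_elem n la F T - w \<in> zp.span ((\<lambda>G. t_elem n la G T) ` smaller_tableaux d n k la F)"
      by (rule t_elem_decomposition[OF assms(2-4,6,8-10) T])
    have "zp.span ((\<lambda>G. t_elem n la G T) ` smaller_tableaux d n k la F) \<subseteq> ideal_gen d X A"
      using X by (intro zp.span_minimal ideal_gen_subspace fA) auto
    with span have "t_elem n la F T - w \<in> ideal_gen d X A" by blast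
    moreover have "t_elem n la F T = w + (t_elem n la F T - w)" by simp
    ultimately show ?thesis unfolding ideal_sum_def using w by blast
  qed
  show ?thesis
  proof (intro conjI allI subsetI)
    fix A :: "'a set" and p :: "('a, 'k) zpoly"
    assume "p \<in> tabloid n la F A"
    then obtain T where T: "bij_betw T (diagram la) A" and p: "p = t_elem n la F T"
      by (auto simp: tabloid_def)
    have fA: "finite A" using T finite_diagram by (metis bij_betw_finite)
    show "p \<in> ideal_sum (ideal_gen d (tabloid k \<mu> (restrict F (diagram \<mu>))))
        (ideal_gen d (\<lambda>B. \<Union>G\<in>smaller_tableaux d n k la F. tabloid n la G B)) A"
      unfolding p using T by (intro in_sum ideal_gen_base fA) (auto simp: tabloid_def)
    show "p \<in> ideal_sum (ideal_gen d (tabloid k \<mu> (restrict F (diagram \<mu>))))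
        (ideal_gen d (\<lambda>B. \<Union>G\<in>smaller_tableaux d n k la F. initial_tabloid k la G B)) A"
      unfolding p using T by (intro in_sum t_elem_in_initial_ideal assms)
  qed
qed

end
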